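(* Let $\mathcal{E},\mathcal{E}_*$ be Hilbert spaces and let $\Theta\in\mathcal{M}_{\mathcal{B}(\mathcal{E},\mathcal{E}_* )}(H^2_n)$. Then $\Theta$ admits a regular inverse if and only if $\operatorname{ran}M_\Theta$ is complemented in $H^2_n\otimes\mathcal{E}_*$, that is, $$H^2_n\otimes\mathcal{E}_*=\operatorname{ran}M_\Theta\stackrel{\cdot}{+}\mathcal{S}$$ for some submodule $\mathcal{S}$ of $H^2_n\otimes\mathcal{E}_*$.
   Context: All Hilbert spaces are complex and separable. $H^2_n$ is the Drury–Arveson space on the open unit ball $\mathbb{B}^n\subset\mathbb{C}^n$, i.e. the reproducing kernel Hilbert space with kernel $(1-\langle\boldsymbol{z},\boldsymbol{w}\rangle)^{-1}$, a Hilbert module over $\mathbb{C}[z_1,\dots,z_n]$ under multiplication. $H^2_n\otimes\mathcal{E}$ is viewed as a space of $\mathcal{E}$-valued holomorphic functions with the operators $M_{z_i}\otimes I_{\mathcal{E}}$. $\mathcal{M}_{\mathcal{B}(\mathcal{E},\mathcal{E}_* )}(H^2_n)$ is the set of holomorphic $\Theta:\mathbb{B}^n\to\mathcal{B}(\mathcal{E},\mathcal{E}_* )$ such that $M_\Theta f=\Theta f$ defines a bounded operator $M_\Theta:H^2_n\otimes\mathcal{E}\to H^2_n\otimes\mathcal{E}_*$. A submodule is a closed subspace invariant under the coordinate multiplication operators. $\stackrel{\cdot}{+}$ denotes an algebraic (not necessarily orthogonal) direct sum. $\Theta$ has a regular inverse if there is $\Psi\in\mathcal{M}_{\mathcal{B}(\mathcal{E}_*,\mathcal{E})}(H^2_n)$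 such that $\Theta(\boldsymbol{z})\Psi(\boldsymbol{z})\Theta(\boldsymbol{z})=\Theta(\boldsymbol{z})$ for all $\boldsymbol{z}\in\mathbb{B}^n$. *)

theory Defs
  imports "HOL-Analysis.Analysis"
begin

class scaleC =
  fixes scaleC :: "complex \<Rightarrow> 'a \<Rightarrow> 'a" (infixr "*\<^sub>C" 75)

text \<open>The inner product is linear in the first argument. Positivity and definiteness are contained
  in the last axiom, since the norm is already a norm.\<close>

class complex_inner = real_normed_vector + scaleC +
  fixes cinner :: "'a \<Rightarrow> 'a \<Rightarrow> complex"
  assumes scaleC_add_right: "a *\<^sub>C (x + y) = a *\<^sub>C x + a *\<^sub>C y"
    and scaleC_add_left: "(a + b) *\<^sub>C x = a *\<^sub>C x + b *\<^sub>C x"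
    and scaleC_scaleC: "a *\<^sub>C b *\<^sub>C x = (a * b) *\<^sub>C x"
    and scaleR_scaleC: "r *\<^sub>R x = complex_of_real r *\<^sub>C x"
    and cinner_commute: "cinner x y = cnj (cinner y x)"
    and cinner_add_left: "cinner (x + y) z = cinner x z + cinner y z"
    and cinner_scaleC_left: "cinner (a *\<^sub>C x) y = a * cinner x y"
    and cinner_self: "cinner x x = complex_of_real ((norm x)\<^sup>2)"

class chilbert_space = complex_inner + complete_space

instantiation complex :: chilbert_space
begin

definition scaleC_complex :: "complex \<Rightarrow> complex \<Rightarrow> complex"
  where "scaleC_complex a x = a * x"

definition cinner_complex :: "complex \<Rightarrow> complex \<Rightarrow> complex"
  where "cinner_complex x y = x * cnj y"

instance
proof
  fix x y z a b :: complex and r :: real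
  show "cinner x x = complex_of_real ((norm x)\<^sup>2)"
    unfolding cinner_complex_def by (simp only: complex_norm_square)
qed (auto simp: scaleC_complex_def cinner_complex_def scaleR_conv_of_real algebra_simps)

end

definition clinear_map :: "('a::complex_inner \<Rightarrow> 'b::complex_inner) \<Rightarrow> bool"
  where "clinear_map f \<longleftrightarrow>
    (\<forall>x y. f (x + y) = f x + f y) \<and> (\<forall>c x. f (c *\<^sub>C x) = c *\<^sub>C f x)"

definition csubspace :: "'a::complex_inner set \<Rightarrow> bool"
  where "csubspace S \<longleftrightarrow>
    0 \<in> S \<and> (\<forall>x\<in>S. \<forall>y\<in>S. x + y \<in> S) \<and> (\<forall>c. \<forall>x\<in>S. c *\<^sub>C x \<in> S)"

definition algebraic_direct_sum :: "'a::complex_inner set \<Rightarrow> 'a set \<Rightarrow> bool"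
  where "algebraic_direct_sum A B \<longleftrightarrow> A \<inter> B = {0} \<and> (\<forall>h. \<exists>a\<in>A. \<exists>b\<in>B. h = a + b)"

text \<open>A Hilbert space of functions on \<open>X\<close> is given as a Hilbert space type together with a
  map \<open>ev\<close> sending each element \<open>f\<close> to the function \<open>ev f\<close> that it is on \<open>X\<close>. The values of
  \<open>ev f\<close> outside \<open>X\<close> are irrelevant.\<close>

definition function_space :: "'x set \<Rightarrow> ('h::complex_inner \<Rightarrow> 'x \<Rightarrow> 'v::complex_inner) \<Rightarrow> bool"
  where "function_space X ev \<longleftrightarrow>
    (\<forall>z\<in>X. clinear_map (\<lambda>f. ev f z)) \<and> (\<forall>f. (\<forall>z\<in>X. ev f z = 0) \<longrightarrow> f = 0)"

definition rkhs :: "'x set \<Rightarrow> ('x \<Rightarrow> 'x \<Rightarrow> complex) \<Rightarrow> ('h::chilbert_space \<Rightarrow> 'x \<Rightarrow> complex) \<Rightarrow> bool"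
  where "rkhs X k ev \<longleftrightarrow> function_space X ev \<and>
    (\<forall>w\<in>X. \<exists>kw. (\<forall>z\<in>X. ev kw z = k z w) \<and> (\<forall>f. cinner f kw = ev f w))"

text \<open>The norm on \<open>complex ^ 'n\<close> is the Euclidean one, so \<open>ball 0 1\<close> is the open unit ball.\<close>

definition drury_arveson_kernel :: "complex ^ 'n \<Rightarrow> complex ^ 'n \<Rightarrow> complex"
  where "drury_arveson_kernel z w = 1 / (1 - (\<Sum>i\<in>UNIV. z $ i * cnj (w $ i)))"

definition drury_arveson :: "('h::chilbert_space \<Rightarrow> complex ^ 'n \<Rightarrow> complex) \<Rightarrow> bool"
  where "drury_arveson ev \<longleftrightarrow> rkhs (ball 0 1) drury_arveson_kernel ev"

text \<open>For a space \<open>'h\<close> of scalar functions, the Hilbert space tensor product of \<open>'h\<close> and \<open>'e\<close>,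
  viewed as a space of \<open>'e\<close>-valued functions: the elementary tensor \<open>t f \<eta>\<close> is the function
  \<open>z \<mapsto> f(z) \<eta>\<close>, inner products of elementary tensors multiply, and the elementary tensors span
  a dense subspace. The function \<open>F\<close> is \<open>z \<mapsto> (ev\<^sub>z \<otimes> I) F\<close>, which the boundedness of the point
  evaluations expresses. The set of elementary tensors is invariant under complex scalars, so its
  real span is its complex span.\<close>

definition function_tensor ::
    "'x set \<Rightarrow> ('h::chilbert_space \<Rightarrow> 'x \<Rightarrow> complex) \<Rightarrow>
      ('t::chilbert_space \<Rightarrow> 'x \<Rightarrow> 'e::chilbert_space) \<Rightarrow> bool"
  where "function_tensor X ev evT \<longleftrightarrow> function_space X evT \<and>
    (\<forall>z\<in>X. \<exists>C. \<forall>F. norm (evT F z) \<le> C * norm F) \<and>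
    (\<exists>t :: 'h \<Rightarrow> 'e \<Rightarrow> 't.
      (\<forall>f \<eta>. \<forall>z\<in>X. evT (t f \<eta>) z = ev f z *\<^sub>C \<eta>) \<and>
      (\<forall>f \<eta> g \<zeta>. cinner (t f \<eta>) (t g \<zeta>) = cinner f g * cinner \<eta> \<zeta>) \<and>
      closure (span {t f \<eta> | f \<eta>. True}) = UNIV)"

definition operator_holomorphic_on ::
    "(complex ^ 'n \<Rightarrow> 'a::complex_inner \<Rightarrow>\<^sub>L 'b::complex_inner) \<Rightarrow> (complex ^ 'n) set \<Rightarrow> bool"
  where "operator_holomorphic_on \<Theta> U \<longleftrightarrow>
    (\<forall>z\<in>U. \<exists>D. (\<Theta> has_derivative D) (at z) \<and>
      (\<forall>c v x. blinfun_apply (D (c *s v)) x = c *\<^sub>C blinfun_apply (D v) x))"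

definition is_mult_op ::
    "('s::chilbert_space \<Rightarrow> complex ^ 'n \<Rightarrow> 'e::chilbert_space) \<Rightarrow>
     ('t::chilbert_space \<Rightarrow> complex ^ 'n \<Rightarrow> 'f::chilbert_space) \<Rightarrow>
     (complex ^ 'n \<Rightarrow> 'e \<Rightarrow>\<^sub>L 'f) \<Rightarrow> ('s \<Rightarrow> 't) \<Rightarrow> bool"
  where "is_mult_op evE evF \<Theta> M \<longleftrightarrow>
    (\<forall>f. \<forall>z\<in>ball 0 1. evF (M f) z = blinfun_apply (\<Theta> z) (evE f z))"

definition mult_op ::
    "('s::chilbert_space \<Rightarrow> complex ^ 'n \<Rightarrow> 'e::chilbert_space) \<Rightarrow>
     ('t::chilbert_space \<Rightarrow> complex ^ 'n \<Rightarrow> 'f::chilbert_space) \<Rightarrow>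
     (complex ^ 'n \<Rightarrow> 'e \<Rightarrow>\<^sub>L 'f) \<Rightarrow> 's \<Rightarrow> 't"
  where "mult_op evE evF \<Theta> = (THE M. is_mult_op evE evF \<Theta> M)"

text \<open>The type \<open>'e \<Rightarrow>\<^sub>L 'f\<close> consists of the bounded real-linear maps; complex linearity of the
  values on the ball is imposed separately.\<close>

definition multiplier ::
    "('s::chilbert_space \<Rightarrow> complex ^ 'n \<Rightarrow> 'e::chilbert_space) \<Rightarrow>
     ('t::chilbert_space \<Rightarrow> complex ^ 'n \<Rightarrow> 'f::chilbert_space) \<Rightarrow>
     (complex ^ 'n \<Rightarrow> 'e \<Rightarrow>\<^sub>L 'f) \<Rightarrow> bool"
  where "multiplier evE evF \<Theta> \<longleftrightarrow>
    (\<forall>z\<in>ball 0 1. clinear_map (blinfun_apply (\<Theta> z))) \<and>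
    operator_holomorphic_on \<Theta> (ball 0 1) \<and>
    (\<exists>M. bounded_linear M \<and> is_mult_op evE evF \<Theta> M)"

lemma is_mult_op_unique:
  assumes "function_space (ball 0 1) evF" "is_mult_op evE evF \<Theta> M" "is_mult_op evE evF \<Theta> N"
  shows "M = N"
proof
  fix f
  have "evF (M f - N f) z = 0" if z: "z \<in> ball 0 1" for z
  proof -
    have add: "evF (x + y) z = evF x z + evF y z" for x y
      using assms(1) z by (auto simp: function_space_def clinear_map_def)
    have "evF (M f) z = evF (N f) z"
      using assms(2,3) z by (simp add: is_mult_op_def)
    then show ?thesis
      using add[of "M f - N f" "N f"] by simp
  qed
  then have "M f - N f = 0"
    using assms(1) unfolding function_space_def by blast
  then show "M f = N f" by simp
qed

lemma mult_op_eqI: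
  assumes "function_space (ball 0 1) evF" "is_mult_op evE evF \<Theta> M"
  shows "mult_op evE evF \<Theta> = M"
  unfolding mult_op_def using assms is_mult_op_unique by (blast intro: the_equality)

definition submodule ::
    "('t::chilbert_space \<Rightarrow> complex ^ 'n \<Rightarrow> 'e::chilbert_space) \<Rightarrow> 't set \<Rightarrow> bool"
  where "submodule ev S \<longleftrightarrow> closed S \<and> csubspace S \<and>
    (\<forall>i. \<forall>f\<in>S. \<exists>g\<in>S. \<forall>z\<in>ball 0 1. ev g z = z $ i *\<^sub>C ev f z)"

definition has_regular_inverse ::
    "('s::chilbert_space \<Rightarrow> complex ^ 'n \<Rightarrow> 'e::chilbert_space) \<Rightarrow>
     ('t::chilbert_space \<Rightarrow> complex ^ 'n \<Rightarrow> 'f::chilbert_space) \<Rightarrow>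
     (complex ^ 'n \<Rightarrow> 'e \<Rightarrow>\<^sub>L 'f) \<Rightarrow> bool"
  where "has_regular_inverse evE evF \<Theta> \<longleftrightarrow>
    (\<exists>\<Psi>. multiplier evF evE \<Psi> \<and> (\<forall>z\<in>ball 0 1. \<Theta> z o\<^sub>L \<Psi> z o\<^sub>L \<Theta> z = \<Theta> z))"

end

theory Submission
  imports Defs
begin

text \<open>If \<open>\<Theta> \<Psi> \<Theta> = \<Theta>\<close>, then \<open>M\<^sub>\<Theta> M\<^sub>\<Psi>\<close> is an idempotent module map with range \<open>ran M\<^sub>\<Theta>\<close>, and its
  kernel is the required submodule.

  Conversely, a complement \<open>S\<close> gives a projection \<open>P\<close> onto \<open>ran M\<^sub>\<Theta>\<close> along \<open>S\<close>. By the open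
  mapping argument \<open>P y = M\<^sub>\<Theta> x\<close> with \<open>norm x \<le> C norm y\<close>, so \<open>P\<close> is bounded and
  \<open>P P\<^sup>* \<le> C\<^sup>2 M\<^sub>\<Theta> M\<^sub>\<Theta>\<^sup>*\<close>. As a bounded module map \<open>P\<close> is multiplication by a function \<open>Q\<close>.
  Testing the operator inequality on kernel functions and using the complete Pick property of the
  Drury-Arveson kernel, a lurking contraction is read off whose transfer function \<open>\<Psi>\<close> is a
  multiplier with \<open>\<Theta> \<Psi> = Q\<close> up to a constant, and then \<open>\<Theta> \<Psi> \<Theta> = Q \<Theta> = \<Theta>\<close>. All operators
  (adjoints, colligations, multiplication operators) are obtained from one Riesz-type statement:
  if the family \<open>v\<close> is dominated by the family \<open>u\<close>, there is a bounded \<open>W\<close> with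
  \<open>\<langle>u\<^sub>i, W y\<rangle> = \<langle>v\<^sub>i, y\<rangle>\<close> for all \<open>i\<close>.\<close>

subsection \<open>Complex inner product spaces\<close>

lemma scaleC_one [simp]: "1 *\<^sub>C x = (x::'a::complex_inner)"
  using scaleR_scaleC[of 1 x] by simp

lemma scaleC_zero_left [simp]: "0 *\<^sub>C x = (0::'a::complex_inner)"
  using scaleR_scaleC[of 0 x] by simp

lemma scaleC_zero_right [simp]: "c *\<^sub>C (0::'a::complex_inner) = 0"
  using scaleC_add_right[of c 0 "0::'a"] by simp

lemma scaleC_minus_left: "(- c) *\<^sub>C x = - (c *\<^sub>C (x::'a::complex_inner))"
  using scaleC_add_left[of "- c" c x] by (simp add: eq_neg_iff_add_eq_0)

lemma scaleC_minus_right: "c *\<^sub>C (- x) = - (c *\<^sub>C (x::'a::complex_inner))"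
  using scaleC_add_right[of c "- x" x] by (simp add: eq_neg_iff_add_eq_0)

lemma scaleC_diff_right: "c *\<^sub>C (x - y) = c *\<^sub>C x - c *\<^sub>C (y::'a::complex_inner)"
  using scaleC_add_right[of c x "- y"] by (simp add: scaleC_minus_right)

lemma scaleC_sum_right: "c *\<^sub>C (\<Sum>i\<in>I. f i) = (\<Sum>i\<in>I. c *\<^sub>C (f i::'a::complex_inner))"
  by (induction I rule: infinite_finite_induct) (simp_all add: scaleC_add_right)

lemma scaleC_sum_left: "(\<Sum>i\<in>I. f i) *\<^sub>C x = (\<Sum>i\<in>I. f i *\<^sub>C (x::'a::complex_inner))"
  by (induction I rule: infinite_finite_induct) (simp_all add: scaleC_add_left)

lemma cinner_zero_left [simp]: "cinner 0 (y::'a::complex_inner) = 0"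
  using cinner_scaleC_left[of 0 0 y] by simp

lemma cinner_minus_left: "cinner (- x) y = - cinner x (y::'a::complex_inner)"
  using cinner_add_left[of x "- x" y] by (simp add: eq_neg_iff_add_eq_0 add.commute)

lemma cinner_diff_left: "cinner (x - y) z = cinner x z - cinner y (z::'a::complex_inner)"
  using cinner_add_left[of x "- y" z] by (simp add: cinner_minus_left)

lemma cinner_sum_left: "cinner (\<Sum>i\<in>I. f i) y = (\<Sum>i\<in>I. cinner (f i) (y::'a::complex_inner))"
  by (induction I rule: infinite_finite_induct) (simp_all add: cinner_add_left)

lemma cinner_add_right: "cinner x (y + z) = cinner x y + cinner x (z::'a::complex_inner)"
  by (subst (1 2 3) cinner_commute) (simp add: cinner_add_left)

lemma cinner_scaleC_right: "cinner x (c *\<^sub>C y) = cnj c * cinner x (y::'a::complex_inner)"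
  by (subst (1 2) cinner_commute) (simp add: cinner_scaleC_left)

lemma cinner_zero_right [simp]: "cinner (x::'a::complex_inner) 0 = 0"
  by (subst cinner_commute) simp

lemma cinner_diff_right: "cinner x (y - z) = cinner x y - cinner x (z::'a::complex_inner)"
  by (subst (1 2 3) cinner_commute) (simp add: cinner_diff_left)

lemma cinner_sum_right: "cinner y (\<Sum>i\<in>I. f i) = (\<Sum>i\<in>I. cinner (y::'a::complex_inner) (f i))"
  by (induction I rule: infinite_finite_induct) (simp_all add: cinner_add_right)

lemma cinner_eqI: "x = y" if "\<And>z. cinner x z = cinner y (z::'a::complex_inner)"
proof -
  have "cinner (x - y) (x - y) = 0"
    by (simp add: cinner_diff_left that)
  then show ?thesis
    by (simp add: cinner_self)
qed

lemma norm_scaleC: "norm (c *\<^sub>C x) = norm c * norm (x::'a::complex_inner)"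
proof -
  have "complex_of_real ((norm (c *\<^sub>C x))\<^sup>2) = c * cnj c * cinner x x"
    unfolding cinner_self[symmetric]
    by (simp add: cinner_scaleC_left cinner_scaleC_right mult_ac)
  also have "\<dots> = complex_of_real ((norm c * norm x)\<^sup>2)"
    by (simp only: cinner_self complex_norm_square[symmetric] of_real_mult[symmetric] power_mult_distrib)
  finally have "(norm (c *\<^sub>C x))\<^sup>2 = (norm c * norm x)\<^sup>2"
    by (simp only: of_real_eq_iff)
  then show ?thesis
    by (rule power2_eq_imp_eq) simp_all
qed

lemma norm_add_square:
  "(norm (x + y))\<^sup>2 = (norm x)\<^sup>2 + (norm y)\<^sup>2 + 2 * Re (cinner x (y::'a::complex_inner))"
proof -
  have "complex_of_real ((norm (x + y))\<^sup>2)
      = of_real ((norm x)\<^sup>2) + of_real ((norm y)\<^sup>2) + (cinner x y + cnj (cinner x y))"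
    unfolding cinner_self[symmetric]
    by (simp add: cinner_add_left cinner_add_right cinner_commute[of y x])
  then have "Re (complex_of_real ((norm (x + y))\<^sup>2))
      = Re (of_real ((norm x)\<^sup>2) + of_real ((norm y)\<^sup>2) + (cinner x y + cnj (cinner x y)))"
    by (rule arg_cong)
  then show ?thesis by simp
qed

text \<open>The triangle inequality is already given, so comparing the expansion of
  \<open>(norm (x + y))\<^sup>2\<close> with \<open>(norm x + norm y)\<^sup>2\<close> bounds the
  real part of the inner product.\<close>

lemma norm_cinner_le: "norm (cinner x y) \<le> norm x * norm (y::'a::complex_inner)"
proof (cases "cinner x y = 0")
  case False
  \<comment> \<open>The unimodular \<open>a\<close> rotates the inner product onto the nonnegative
    real axis, where it equals its real part.\<close>
  define a where "a = cnj (cinner x y) / of_real (norm (cinner x y))"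
  have na: "norm a = 1"
    using False by (simp add: a_def norm_divide)
  have "a * cinner x y = of_real (norm (cinner x y))"
    using False by (simp add: a_def mult.commute[of "cnj _"] complex_norm_square[symmetric] power2_eq_square)
  then have "norm (cinner x y) = Re (cinner (a *\<^sub>C x) y)"
    by (simp add: cinner_scaleC_left)
  also have "\<dots> \<le> norm (a *\<^sub>C x) * norm y"
  proof -
    have "(norm (a *\<^sub>C x + y))\<^sup>2 \<le> (norm (a *\<^sub>C x) + norm y)\<^sup>2"
      by (intro power_mono norm_triangle_ineq) simp
    then show ?thesis
      by (simp add: norm_add_square power2_sum)
  qed
  finally show ?thesis
    by (simp add: norm_scaleC na)
qed simp

lemma bounded_bilinear_cinner: "bounded_bilinear (cinner :: 'a::complex_inner \<Rightarrow> _)"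
proof
  show "\<exists>K. \<forall>a b::'a. norm (cinner a b) \<le> norm a * norm b * K"
    by (rule exI[of _ 1]) (simp add: norm_cinner_le)
qed (simp_all add: cinner_add_left cinner_add_right scaleR_scaleC cinner_scaleC_left
    cinner_scaleC_right scaleC_complex_def scaleR_conv_of_real)

lemmas tendsto_cinner [tendsto_intros] = bounded_bilinear.tendsto[OF bounded_bilinear_cinner]
lemmas continuous_on_cinner [continuous_intros] =
  bounded_bilinear.continuous_on[OF bounded_bilinear_cinner]

lemma norm_lincomb_square:
  "complex_of_real ((norm (\<Sum>i\<in>I. c i *\<^sub>C (u i::'a::complex_inner)))\<^sup>2)
    = (\<Sum>i\<in>I. \<Sum>j\<in>I. c i * cnj (c j) * cinner (u i) (u j))"
  unfolding cinner_self[symmetric] cinner_sum_left cinner_sum_right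
  by (subst sum.swap) (simp add: cinner_scaleC_left cinner_scaleC_right mult_ac)

instance chilbert_space \<subseteq> banach ..

section \<open>Finite direct sums of Hilbert spaces\<close>

instantiation prod :: (complex_inner, complex_inner) complex_inner
begin

definition scaleC_prod :: "complex \<Rightarrow> 'a \<times> 'b \<Rightarrow> 'a \<times> 'b"
  where "scaleC_prod c p = (c *\<^sub>C fst p, c *\<^sub>C snd p)"

definition cinner_prod :: "'a \<times> 'b \<Rightarrow> 'a \<times> 'b \<Rightarrow> complex"
  where "cinner_prod p q = cinner (fst p) (fst q) + cinner (snd p) (snd q)"

instance
proof
  fix x y z :: "'a \<times> 'b" and a b :: complex and r :: real
  show "cinner x y = cnj (cinner y x)"
    unfolding cinner_prod_def by (subst (1 2) cinner_commute) simp
  show "cinner x x = complex_of_real ((norm x)\<^sup>2)"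
    by (simp add: cinner_prod_def cinner_self norm_prod_def)
qed (auto simp: scaleC_prod_def cinner_prod_def scaleC_add_right scaleC_add_left scaleC_scaleC
    scaleR_prod_def scaleR_scaleC cinner_add_left cinner_scaleC_left algebra_simps)

end

instance prod :: (chilbert_space, chilbert_space) chilbert_space ..

instantiation vec :: (complex_inner, finite) complex_inner
begin

definition scaleC_vec :: "complex \<Rightarrow> 'a ^ 'b \<Rightarrow> 'a ^ 'b"
  where "scaleC_vec c v = (\<chi> i. c *\<^sub>C v $ i)"

definition cinner_vec :: "'a ^ 'b \<Rightarrow> 'a ^ 'b \<Rightarrow> complex"
  where "cinner_vec v w = (\<Sum>i\<in>UNIV. cinner (v $ i) (w $ i))"

instance
proof
  fix x y z :: "'a ^ 'b" and a b :: complex and r :: real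
  show "cinner x y = cnj (cinner y x)"
    unfolding cinner_vec_def cnj_sum by (intro sum.cong refl cinner_commute)
  show "cinner x x = complex_of_real ((norm x)\<^sup>2)"
    by (simp add: cinner_vec_def cinner_self norm_vec_def L2_set_def sum_nonneg)
qed (auto simp: scaleC_vec_def cinner_vec_def scaleC_add_right scaleC_add_left scaleC_scaleC
    vec_eq_iff scaleR_scaleC cinner_add_left cinner_scaleC_left sum.distrib sum_distrib_left)

end

instance vec :: (chilbert_space, finite) chilbert_space ..

text \<open>The explicit bound \<open>C\<close> passes unchanged from an operator to its adjoint.
  Complex linearity is part of the notion because the type of bounded operators records only real
  linearity.\<close>

definition bounded_clinear :: "('a::complex_inner \<Rightarrow> 'b::complex_inner) \<Rightarrow> real \<Rightarrow> bool"
  where "bounded_clinear T C \<longleftrightarrow> clinear_map T \<and> (\<forall>x. norm (T x) \<le> C * norm x)"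

lemma clinear_mapD:
  assumes "clinear_map f"
  shows "f (x + y) = f x + f y" "f (c *\<^sub>C x) = c *\<^sub>C f x" "f 0 = 0" "f (- x) = - f x"
    "f (x - y) = f x - f y" "f (\<Sum>i\<in>I. g i) = (\<Sum>i\<in>I. f (g i))" "linear f"
proof -
  show add: "f (x + y) = f x + f y" for x y
    using assms by (simp add: clinear_map_def)
  show sc: "f (c *\<^sub>C x) = c *\<^sub>C f x" for c x
    using assms by (simp add: clinear_map_def)
  show "linear f"
    by (rule linearI) (simp_all add: add sc scaleR_scaleC)
  then show "f 0 = 0" "f (- x) = - f x" "f (x - y) = f x - f y"
      "f (\<Sum>i\<in>I. g i) = (\<Sum>i\<in>I. f (g i))"
    by (simp_all add: linear_0 linear_neg linear_diff linear_sum)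
qed

lemma clinear_map_compose: "clinear_map f \<Longrightarrow> clinear_map g \<Longrightarrow> clinear_map (\<lambda>x. f (g x))"
  by (simp add: clinear_map_def)

lemma bounded_clinear_imp_bounded_linear: "bounded_clinear T C \<Longrightarrow> bounded_linear T"
  unfolding bounded_clinear_def
  by (intro linear_conv_bounded_linear[THEN iffD2] bounded_linear.intro bounded_linear_axioms.intro
      clinear_mapD(7) exI[of _ C]) (auto simp: mult.commute)

lemma bounded_linear_imp_bounded_clinear:
  assumes "bounded_linear T" "clinear_map T"
  obtains C where "0 \<le> C" "bounded_clinear T C"
proof -
  interpret bounded_linear T by fact
  from nonneg_bounded show ?thesis
    using assms(2) that by (auto simp: bounded_clinear_def mult.commute)
qed

subsection \<open>Riesz representation for families\<close>

text \<open>\<open>G\<close> is the graph of a functional on the subspace of its first components;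
  \<open>bound\<close> makes it single-valued. The representing vector is the limit of a minimizing
  sequence, as in the projection theorem, and the closure clause singles it out among all
  representatives.\<close>

lemma riesz_subspace:
  fixes G :: "('a::chilbert_space \<times> complex) set"
  assumes G: "csubspace G" and bound: "\<And>s \<beta>. (s, \<beta>) \<in> G \<Longrightarrow> norm \<beta> \<le> C * norm s" and "0 \<le> C"
  shows "\<exists>x. (\<forall>s \<beta>. (s, \<beta>) \<in> G \<longrightarrow> cinner s x = \<beta>) \<and> norm x \<le> C \<and> x \<in> closure (fst ` G)"
proof -
  \<comment> \<open>For the sought \<open>x\<close> and \<open>p\<close> in \<open>G\<close>,
    \<open>J p\<close> equals \<open>(norm (fst p - x))\<^sup>2 - (norm x)\<^sup>2\<close>, so
    minimizing \<open>J\<close> approximates \<open>x\<close>.\<close>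
  define J where "J p = (norm (fst p))\<^sup>2 - 2 * Re (snd p)" for p :: "'a \<times> complex"
  have G0: "0 \<in> G" and Gadd: "\<And>p q. p \<in> G \<Longrightarrow> q \<in> G \<Longrightarrow> p + q \<in> G"
    and Gsc: "\<And>c p. p \<in> G \<Longrightarrow> c *\<^sub>C p \<in> G"
    using G by (auto simp: csubspace_def)
  have Jlow: "- (C\<^sup>2) \<le> J p" if "p \<in> G" for p
  proof -
    have "Re (snd p) \<le> C * norm (fst p)"
      using bound[of "fst p" "snd p"] that complex_Re_le_cmod[of "snd p"] by simp
    moreover have "0 \<le> (norm (fst p) - C)\<^sup>2" by simp
    ultimately show ?thesis
      unfolding J_def power2_diff mult.assoc by (simp add: mult.commute)
  qed
  define m where "m = Inf (J ` G)"
  have bdd: "bdd_below (J ` G)"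
    by (rule bdd_belowI2[of _ "- (C\<^sup>2)"]) (rule Jlow)
  have m_le: "m \<le> J p" if "p \<in> G" for p
    unfolding m_def using that bdd by (simp add: cINF_lower)
  have "\<exists>p\<in>G. J p < m + inverse (Suc n)" for n
    using cInf_lessD[of "J ` G" "m + inverse (Suc n)"] G0 by (auto simp: m_def)
  then obtain p where pG: "\<And>n. p n \<in> G" and pJ: "\<And>n. J (p n) < m + inverse (Suc n)"
    by metis
  define s where "s n = fst (p n)" for n
  \<comment> \<open>Parallelogram law: the midpoint of \<open>p i\<close> and \<open>p j\<close>
    lies in \<open>G\<close>, so \<open>J\<close> is at least \<open>m\<close> there.\<close>
  have half: "(norm (s i - s j))\<^sup>2 \<le> 2 * (inverse (Suc i) + inverse (Suc j))" for i j
  proof -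
    have "m \<le> J ((1/2) *\<^sub>C (p i + p j))"
      by (intro m_le Gsc Gadd pG)
    then have "4 * m \<le> (norm (s i + s j))\<^sup>2 - 4 * (Re (snd (p i)) + Re (snd (p j)))"
      by (simp add: J_def s_def scaleC_prod_def norm_scaleC scaleC_complex_def power_mult_distrib
          power2_eq_square norm_divide field_simps)
    moreover have "(norm (s i + s j))\<^sup>2 + (norm (s i - s j))\<^sup>2 = 2 * (norm (s i))\<^sup>2 + 2 * (norm (s j))\<^sup>2"
      using norm_add_square[of "s i" "s j"] norm_add_square[of "s i" "- s j"]
      by (simp add: cinner_diff_right[of "s i" 0, simplified])
    ultimately show ?thesis
      using pJ[of i] pJ[of j] unfolding J_def s_def by simp
  qed
  have "Cauchy s"
  proof (rule metric_CauchyI)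
    fix e :: real assume e: "0 < e"
    obtain N where N: "inverse (real (Suc N)) < e\<^sup>2 / 4"
      using reals_Archimedean[of "e\<^sup>2 / 4"] e by auto
    have "dist (s i) (s j) < e" if "N \<le> i" "N \<le> j" for i j
    proof -
      have "inverse (real (Suc i)) \<le> inverse (real (Suc N))"
          "inverse (real (Suc j)) \<le> inverse (real (Suc N))"
        using that by (simp_all add: field_simps)
      then have "2 * (inverse (real (Suc i)) + inverse (real (Suc j)))
          \<le> 2 * (inverse (real (Suc N)) + inverse (real (Suc N)))"
        by (intro mult_left_mono add_mono) auto
      also have "\<dots> < e\<^sup>2"
        using N by simp
      finally have "(norm (s i - s j))\<^sup>2 < e\<^sup>2"
        using half[of i j] by (rule le_less_trans[rotated])
      then show ?thesis
        using e by (simp add: dist_norm power_less_imp_less_base)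
    qed
    then show "\<exists>M. \<forall>i\<ge>M. \<forall>j\<ge>M. dist (s i) (s j) < e" by blast
  qed
  then obtain x where x: "s \<longlonglongrightarrow> x"
    using Cauchy_convergent convergent_def by blast
  have Re_eq: "Re (cinner t x) = Re \<beta>" if tG: "(t, \<beta>) \<in> G" for t \<beta>
  proof -
    define d where "d = Re (cinner x t) - Re \<beta>"
    \<comment> \<open>Moving \<open>p n\<close> by \<open>r\<close> times
      \<open>(t, \<beta>)\<close> cannot push \<open>J\<close> below \<open>m\<close>. The limit is
      a quadratic in \<open>r\<close> without constant term that is never negative, so its linear
      coefficient vanishes.\<close>
    have ineq: "0 \<le> 2 * r * d + r\<^sup>2 * (norm t)\<^sup>2" for r :: real
    proof -
      have "- inverse (Suc n) \<le> 2 * r * (Re (cinner (s n) t) - Re \<beta>) + r\<^sup>2 * (norm t)\<^sup>2" for n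
      proof -
        have "m \<le> J (p n + of_real r *\<^sub>C (t, \<beta>))"
          by (intro m_le Gadd Gsc pG tG)
        also have "\<dots> = J (p n) + 2 * r * (Re (cinner (s n) t) - Re \<beta>) + r\<^sup>2 * (norm t)\<^sup>2"
          by (simp add: J_def s_def scaleC_prod_def norm_add_square norm_scaleC cinner_scaleC_right
              scaleC_complex_def power_mult_distrib algebra_simps)
        finally show ?thesis using pJ[of n] by simp
      qed
      moreover have "(\<lambda>n. - inverse (real (Suc n))) \<longlonglongrightarrow> - 0"
        by (intro tendsto_minus LIMSEQ_inverse_real_of_nat)
      moreover have "(\<lambda>n. 2 * r * (Re (cinner (s n) t) - Re \<beta>) + r\<^sup>2 * (norm t)\<^sup>2)
          \<longlonglongrightarrow> 2 * r * d + r\<^sup>2 * (norm t)\<^sup>2"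
        unfolding d_def by (intro tendsto_intros x)
      ultimately show ?thesis
        using LIMSEQ_le[of "\<lambda>n. - inverse (real (Suc n))" "- 0"] by auto
    qed
    have "d = 0"
    proof (rule ccontr)
      assume d: "d \<noteq> 0"
      \<comment> \<open>The test value is \<open>r = - d / q\<close>; the added 1 keeps
        \<open>q\<close> positive when \<open>t = 0\<close>.\<close>
      define q where "q = (norm t)\<^sup>2 + 1"
      have q: "0 < q" "(norm t)\<^sup>2 < q" by (simp_all add: q_def add_nonneg_pos)
      have "0 \<le> 2 * (- d / q) * d + (- d / q)\<^sup>2 * (norm t)\<^sup>2" by (rule ineq)
      also have "\<dots> \<le> 2 * (- d / q) * d + (- d / q)\<^sup>2 * q"
        using q by (intro add_left_mono mult_left_mono) auto
      also have "\<dots> = - (d\<^sup>2 / q)"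
        using q by (simp add: power2_eq_square divide_simps)
      also have "\<dots> < 0" using d q(1) by simp
      finally show False by simp
    qed
    then show ?thesis
      unfolding d_def by (subst cinner_commute) simp
  qed
  have eq: "cinner t x = \<beta>" if "(t, \<beta>) \<in> G" for t \<beta>
  proof (rule complex_eqI)
    show "Re (cinner t x) = Re \<beta>" using that by (rule Re_eq)
    have "(\<i> *\<^sub>C t, \<i> * \<beta>) \<in> G"
      using Gsc[OF that, of \<i>] by (simp add: scaleC_prod_def scaleC_complex_def)
    from Re_eq[OF this] show "Im (cinner t x) = Im \<beta>"
      by (simp add: cinner_scaleC_left)
  qed
  have "(norm x)\<^sup>2 \<le> C * norm x"
  proof -
    have "norm (cinner (s n) x) \<le> C * norm (s n)" for n
      using eq[of "s n" "snd (p n)"] bound[of "s n" "snd (p n)"] pG[of n] by (simp add: s_def)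
    moreover have "(\<lambda>n. norm (cinner (s n) x)) \<longlonglongrightarrow> norm (cinner x x)"
      "(\<lambda>n. C * norm (s n)) \<longlonglongrightarrow> C * norm x"
      by (intro tendsto_intros x)+
    ultimately have "norm (cinner x x) \<le> C * norm x"
      using LIMSEQ_le by blast
    then show ?thesis by (simp add: cinner_self norm_power)
  qed
  then have "norm x \<le> C"
    using \<open>0 \<le> C\<close> by (cases "norm x = 0") (auto simp: power2_eq_square)
  moreover have "x \<in> closure (fst ` G)"
    using x pG unfolding closure_sequential by (intro exI[of _ s]) (auto simp: s_def)
  ultimately show ?thesis using eq by blast
qed

lemma lincombs_csubspace:
  fixes u :: "'i \<Rightarrow> 'a::complex_inner"
  shows "csubspace {\<Sum>i\<in>I. c i *\<^sub>C u i | I c. finite I \<and> I \<subseteq> A}" (is "csubspace ?S")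
  unfolding csubspace_def
proof (intro conjI ballI allI)
  show "0 \<in> ?S"
    by (rule CollectI, rule exI[of _ "{}"]) simp
  fix x assume "x \<in> ?S"
  then obtain I c where x: "x = (\<Sum>i\<in>I. c i *\<^sub>C u i)" "finite I" "I \<subseteq> A" by blast
  show "a *\<^sub>C x \<in> ?S" for a
    using x by (intro CollectI exI[of _ I] exI[of _ "\<lambda>i. a * c i"])
      (simp add: scaleC_sum_right scaleC_scaleC)
  fix y assume "y \<in> ?S"
  then obtain I' c' where y: "y = (\<Sum>i\<in>I'. c' i *\<^sub>C u i)" "finite I'" "I' \<subseteq> A" by blast
  define d where "d i = (if i \<in> I then c i else 0)" for i
  define d' where "d' i = (if i \<in> I' then c' i else 0)" for i
  have "x = (\<Sum>i\<in>I \<union> I'. d i *\<^sub>C u i)"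
    unfolding x(1) using x y by (intro sum.mono_neutral_cong_left) (auto simp: d_def)
  moreover have "y = (\<Sum>i\<in>I \<union> I'. d' i *\<^sub>C u i)"
    unfolding y(1) using x y by (intro sum.mono_neutral_cong_left) (auto simp: d'_def)
  ultimately have "x + y = (\<Sum>i\<in>I \<union> I'. (d i + d' i) *\<^sub>C u i)"
    by (simp add: sum.distrib scaleC_add_left)
  then show "x + y \<in> ?S"
    using x y by (intro CollectI exI[of _ "I \<union> I'"] exI[of _ "\<lambda>i. d i + d' i"]) simp
qed

text \<open>\<open>W\<close> is the adjoint of the map sending each \<open>u i\<close> to
  \<open>v i\<close>, which the hypothesis bounds by \<open>C\<close> on linear combinations. Each
  \<open>W y\<close> is the Riesz vector of the functional sending \<open>u i\<close> to
  \<open>cinner (v i) y\<close>.\<close>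

lemma dominated_family_adjoint:
  fixes u :: "'i \<Rightarrow> 'a::chilbert_space" and v :: "'i \<Rightarrow> 'b::complex_inner"
  assumes le: "\<And>I c. finite I \<Longrightarrow> I \<subseteq> A \<Longrightarrow>
      norm (\<Sum>i\<in>I. c i *\<^sub>C v i) \<le> C * norm (\<Sum>i\<in>I. c i *\<^sub>C u i)"
    and "0 \<le> C"
  shows "\<exists>W. bounded_clinear W C \<and> (\<forall>i\<in>A. \<forall>y. cinner (u i) (W y) = cinner (v i) y)"
proof -
  \<comment> \<open>The last clause expresses that \<open>x\<close> lies in the closed span of the
    \<open>u i\<close>. It determines \<open>x\<close> uniquely, which is what makes
    \<open>W\<close> linear.\<close>
  have "\<exists>x. (\<forall>i\<in>A. cinner (u i) x = cinner (v i) y) \<and> norm x \<le> C * norm y \<and>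
      (\<forall>z. (\<forall>i\<in>A. cinner (u i) z = 0) \<longrightarrow> cinner x z = 0)" for y
  proof -
    let ?uv = "\<lambda>i. (u i, cinner (v i) y)"
    define G where "G = {\<Sum>i\<in>I. c i *\<^sub>C ?uv i | I c. finite I \<and> I \<subseteq> A}"
    have elt: "(\<Sum>i\<in>I. c i *\<^sub>C ?uv i) = (\<Sum>i\<in>I. c i *\<^sub>C u i, cinner (\<Sum>i\<in>I. c i *\<^sub>C v i) y)" for I c
      by (simp add: scaleC_prod_def prod_eq_iff fst_sum snd_sum cinner_sum_left
          cinner_scaleC_left scaleC_complex_def)
    have bound: "norm \<beta> \<le> (C * norm y) * norm s" if sG: "(s, \<beta>) \<in> G" for s \<beta>
    proof -
      obtain I c where I: "finite I" "I \<subseteq> A" and s: "s = (\<Sum>i\<in>I. c i *\<^sub>C u i)"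
        and \<beta>: "\<beta> = cinner (\<Sum>i\<in>I. c i *\<^sub>C v i) y"
        using sG unfolding G_def elt by blast
      have "norm \<beta> \<le> norm (\<Sum>i\<in>I. c i *\<^sub>C v i) * norm y"
        unfolding \<beta> by (rule norm_cinner_le)
      also have "\<dots> \<le> (C * norm s) * norm y"
        unfolding s by (intro mult_right_mono le I) simp
      finally show ?thesis by (simp add: mult_ac)
    qed
    have "0 \<le> C * norm y"
      using \<open>0 \<le> C\<close> by simp
    from riesz_subspace[OF _ bound this] obtain x
      where x: "\<And>s \<beta>. (s, \<beta>) \<in> G \<Longrightarrow> cinner s x = \<beta>" and nx: "norm x \<le> C * norm y"
        and cl: "x \<in> closure (fst ` G)"
      using lincombs_csubspace[of ?uv A] unfolding G_def by blast
    have "cinner (u i) x = cinner (v i) y" if "i \<in> A" for i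
    proof (rule x)
      show "?uv i \<in> G"
        unfolding G_def using that
        by (intro CollectI exI[of _ "{i}"] exI[of _ "\<lambda>i. 1"]) (simp add: scaleC_prod_def)
    qed
    moreover have "cinner x z = 0" if z: "\<forall>i\<in>A. cinner (u i) z = 0" for z
    proof -
      have "fst ` G \<subseteq> {x. cinner x z = 0}"
        unfolding G_def elt using z
        by (auto simp: cinner_sum_left cinner_scaleC_left subset_iff intro!: sum.neutral)
      moreover have "closed {x. cinner x z = 0}"
        by (intro closed_Collect_eq continuous_intros)
      ultimately show ?thesis
        using cl closure_minimal by blast
    qed
    ultimately show ?thesis using nx by blast
  qed
  then obtain W where W: "\<And>i y. i \<in> A \<Longrightarrow> cinner (u i) (W y) = cinner (v i) y"
    and nW: "\<And>y. norm (W y) \<le> C * norm y"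
    and perp: "\<And>y z. (\<forall>i\<in>A. cinner (u i) z = 0) \<Longrightarrow> cinner (W y) z = 0"
    by metis
  have "W (x + y) = W x + W y" for x y
  proof -
    let ?z = "W (x + y) - W x - W y"
    \<comment> \<open>\<open>?z\<close> is orthogonal to every \<open>u i\<close>, and by
      \<open>perp\<close> each of its three terms is orthogonal to any such vector, so
      \<open>?z\<close> is orthogonal to itself.\<close>
    have "\<forall>i\<in>A. cinner (u i) ?z = 0"
      by (simp add: cinner_diff_right W cinner_add_right)
    then have "cinner ?z ?z = 0"
      by (subst cinner_diff_left, subst cinner_diff_left) (simp add: perp)
    then show ?thesis by (simp add: cinner_self algebra_simps)
  qed
  moreover have "W (c *\<^sub>C x) = c *\<^sub>C W x" for c x
  proof -
    let ?z = "W (c *\<^sub>C x) - c *\<^sub>C W x"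
    have "\<forall>i\<in>A. cinner (u i) ?z = 0"
      by (simp add: cinner_diff_right W cinner_scaleC_right)
    then have "cinner ?z ?z = 0"
      by (subst cinner_diff_left) (simp add: perp cinner_scaleC_left)
    then show ?thesis by (simp add: cinner_self)
  qed
  ultimately show ?thesis
    using W nW by (intro exI[of _ W]) (simp add: bounded_clinear_def clinear_map_def)
qed

text \<open>The family statement with \<open>u\<close> the identity and \<open>v = T\<close>,
  indexed by the whole space.\<close>

lemma adjoint_exists:
  fixes T :: "'a::chilbert_space \<Rightarrow> 'b::complex_inner"
  assumes "bounded_clinear T C" "0 \<le> C"
  shows "\<exists>T'. bounded_clinear T' C \<and> (\<forall>x y. cinner (T x) y = cinner x (T' y))"
proof -
  have T: "clinear_map T" and n: "\<And>x. norm (T x) \<le> C * norm x"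
    using assms(1) by (auto simp: bounded_clinear_def)
  have eq: "(\<Sum>i\<in>I. c i *\<^sub>C T i) = T (\<Sum>i\<in>I. c i *\<^sub>C i)" for I c
    by (simp add: clinear_mapD[OF T])
  show ?thesis
    using dominated_family_adjoint[of UNIV T C "\<lambda>x. x"] n \<open>0 \<le> C\<close> unfolding eq by fastforce
qed

subsection \<open>Bounded operators\<close>

text \<open>The fixpoint \<open>Y\<close> makes \<open>1 - Y\<close> a self-adjoint square root of \<open>1 - S\<close>.\<close>

lemma selfadjoint_quadratic_fixpoint:
  fixes S :: "'a::chilbert_space \<Rightarrow>\<^sub>L 'a"
  assumes nS: "norm S \<le> 1/2" and S: "\<And>x y. cinner (S x) y = cinner x (S y)"
  shows "\<exists>Y :: 'a \<Rightarrow>\<^sub>L 'a. (\<forall>x y. cinner (blinfun_apply Y x) y = cinner x (blinfun_apply Y y)) \<and> (1/2) *\<^sub>R (S + (Y o\<^sub>L Y)) = Y"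
proof -
  \<comment> \<open>Radius 1/2 makes \<open>?f\<close> a contraction, since
    \<open>Y Y - Z Z = Y (Y - Z) + (Y - Z) Z\<close>. Self-adjointness is a closed condition, so the
    fixpoint inherits it.\<close>
  let ?s = "{Y :: 'a \<Rightarrow>\<^sub>L 'a. norm Y \<le> 1/2 \<and> (\<forall>x y. cinner (blinfun_apply Y x) y = cinner x (blinfun_apply Y y))}"
  let ?f = "\<lambda>Y :: 'a \<Rightarrow>\<^sub>L 'a. (1/2) *\<^sub>R (S + (Y o\<^sub>L Y))"
  have "closed ?s"
    by (intro closed_Collect_conj closed_Collect_all closed_Collect_eq closed_Collect_le
        continuous_intros)
  then have "complete ?s"
    by (simp add: complete_eq_closed)
  moreover have "?s \<noteq> {}"
    by (auto intro!: exI[of _ 0])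
  moreover have "?f ` ?s \<subseteq> ?s"
  proof (clarify, intro conjI allI)
    fix Y :: "'a \<Rightarrow>\<^sub>L 'a"
    assume nY: "norm Y \<le> 1/2" and Y: "\<forall>x y. cinner (blinfun_apply Y x) y = cinner x (blinfun_apply Y y)"
    have "norm (Y o\<^sub>L Y) \<le> 1/2 * (1/2)"
      using norm_blinfun_compose[of Y Y] mult_mono[OF nY nY] by simp
    then show "norm (?f Y) \<le> 1/2"
      using norm_triangle_ineq[of S "Y o\<^sub>L Y"] nS by simp
    show "cinner (?f Y x) y = cinner x (?f Y y)" for x y
      using Y by (simp add: blinfun.scaleR_left blinfun.add_left scaleR_scaleC cinner_scaleC_left
          cinner_scaleC_right cinner_add_left cinner_add_right S)
  qed
  moreover have "\<forall>Y\<in>?s. \<forall>Z\<in>?s. dist (?f Y) (?f Z) \<le> 1/2 * dist Y Z"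
  proof (intro ballI)
    fix Y Z :: "'a \<Rightarrow>\<^sub>L 'a" assume YZ: "Y \<in> ?s" "Z \<in> ?s"
    have "?f Y - ?f Z = (1/2) *\<^sub>R ((Y o\<^sub>L (Y - Z)) + ((Y - Z) o\<^sub>L Z))"
      by (rule blinfun_eqI) (simp add: blinfun.scaleR_left blinfun.add_left blinfun.diff_left
          blinfun.diff_right algebra_simps)
    then have "norm (?f Y - ?f Z) \<le> 1/2 * (norm (Y o\<^sub>L (Y - Z)) + norm ((Y - Z) o\<^sub>L Z))"
      by (simp add: norm_triangle_ineq)
    also have "\<dots> \<le> 1/2 * (1/2 * norm (Y - Z) + norm (Y - Z) * (1/2))"
      using YZ by (intro mult_left_mono add_mono order_trans[OF norm_blinfun_compose]
          mult_right_mono mult_left_mono) auto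
    finally show "dist (?f Y) (?f Z) \<le> 1/2 * dist Y Z"
      by (simp add: dist_norm)
  qed
  ultimately obtain Y where "Y \<in> ?s" "?f Y = Y"
    using Banach_fix[of ?s "1/2" ?f] by auto
  then show ?thesis by blast
qed

text \<open>There is a \<open>W'\<close> with \<open>W' (A x) = B x\<close>, so the right side is
  \<open>c\<^sup>2\<close> times the inner product of \<open>(1 - S) (A x)\<close> with
  \<open>A y\<close>, where \<open>S\<close> is \<open>W W'\<close> divided by
  \<open>c\<^sup>2\<close>. A self-adjoint square root \<open>1 - Y\<close> of \<open>1 - S\<close>
  gives \<open>\<Gamma>\<close> as \<open>c (1 - Y) A\<close>.\<close>

lemma domination_defect:
  fixes A :: "'a::complex_inner \<Rightarrow> 'b::chilbert_space" and B :: "'a \<Rightarrow> 'c::chilbert_space"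
  assumes A: "clinear_map A" and B: "clinear_map B"
    and le: "\<And>x. norm (B x) \<le> C * norm (A x)" and C: "0 \<le> C"
  shows "\<exists>c>0. \<exists>\<Gamma> :: 'a \<Rightarrow> 'b. \<forall>x y.
    cinner (\<Gamma> x) (\<Gamma> y) = (complex_of_real c)\<^sup>2 * cinner (A x) (A y) - cinner (B x) (B y)"
proof -
  have eqs: "(\<Sum>i\<in>I. c i *\<^sub>C A i) = A (\<Sum>i\<in>I. c i *\<^sub>C i)" "(\<Sum>i\<in>I. c i *\<^sub>C B i) = B (\<Sum>i\<in>I. c i *\<^sub>C i)" for I c
    by (simp_all add: clinear_mapD[OF A] clinear_mapD[OF B])
  obtain W where W: "bounded_clinear W C" "\<And>x y. cinner (A x) (W y) = cinner (B x) y"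
    using dominated_family_adjoint[of UNIV B C A] le C unfolding eqs by blast
  obtain W' where W': "bounded_clinear W' C" "\<And>x y. cinner (W x) y = cinner x (W' y)"
    using adjoint_exists[OF W(1) C] by blast
  \<comment> \<open>\<open>W\<close> is the adjoint of the map \<open>A x \<mapsto> B x\<close>, so
    the adjoint \<open>W'\<close> of \<open>W\<close> extends that map.\<close>
  have W'A: "W' (A x) = B x" for x
  proof (rule cinner_eqI)
    fix y
    show "cinner (W' (A x)) y = cinner (B x) y"
      by (subst cinner_commute) (simp add: W'(2)[symmetric] W(2)[symmetric] cinner_commute[of "A x"])
  qed
  \<comment> \<open>This choice brings the norm of \<open>S\<close> down to 1/2, as the fixpoint
    lemma requires; the summand 1 keeps \<open>c\<close> positive when \<open>C = 0\<close>.\<close>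
  define c where "c = sqrt (2 * C\<^sup>2 + 1)"
  have c: "0 < c" "c\<^sup>2 = 2 * C\<^sup>2 + 1"
    by (simp_all add: c_def add_nonneg_pos)
  have lin: "bounded_linear (\<lambda>x. W (W' x))"
    using bounded_linear_compose[OF bounded_clinear_imp_bounded_linear[OF W(1)]
        bounded_clinear_imp_bounded_linear[OF W'(1)]] .
  define S where "S = (1 / c\<^sup>2) *\<^sub>R Blinfun (\<lambda>x. W (W' x))"
  have S_apply: "S x = of_real (1 / c\<^sup>2) *\<^sub>C W (W' x)" for x
    by (simp add: S_def blinfun.scaleR_left bounded_linear_Blinfun_apply[OF lin] scaleR_scaleC)
  have SA: "cinner (S x) y = of_real (1 / c\<^sup>2) * cinner (W' x) (W' y)" for x y
    by (simp add: S_apply cinner_scaleC_left W'(2))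
  have "norm S \<le> 1/2"
  proof (rule norm_blinfun_bound)
    fix x
    have "norm (W (W' x)) \<le> C * (C * norm x)"
      using W(1) W'(1) C unfolding bounded_clinear_def
      by (meson mult_left_mono order_trans)
    then have "norm (S x) \<le> (1 / c\<^sup>2) * (C * (C * norm x))"
      by (simp add: S_apply norm_scaleC norm_divide norm_power divide_right_mono)
    also have "\<dots> = (C\<^sup>2 / c\<^sup>2) * norm x"
      by (simp add: power2_eq_square)
    also have "\<dots> \<le> 1/2 * norm x"
      by (intro mult_right_mono) (simp_all add: c(2) divide_simps add_nonneg_pos)
    finally show "norm (S x) \<le> 1/2 * norm x" .
  qed simp
  moreover have S_sym: "cinner (S x) y = cinner x (S y)" for x y
    by (subst (2) cinner_commute) (simp add: SA cinner_commute[of "W' y"])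
  ultimately obtain Y :: "'b \<Rightarrow>\<^sub>L 'b" where Ysym: "\<And>x y. cinner (blinfun_apply Y x) y = cinner x (blinfun_apply Y y)"
    and Y: "(1/2) *\<^sub>R (S + (Y o\<^sub>L Y)) = Y"
    using selfadjoint_quadratic_fixpoint by blast
  \<comment> \<open>The fixpoint equation solved for \<open>Y Y\<close>; it says that
    \<open>1 - Y\<close> squares to \<open>1 - S\<close>.\<close>
  have YY: "Y (Y x) = 2 *\<^sub>R Y x - S x" for x
  proof -
    have "(1/2) *\<^sub>R (S x + Y (Y x)) = Y x"
      by (subst (3) Y[symmetric]) (simp add: blinfun.scaleR_left blinfun.add_left)
    then have "2 *\<^sub>R Y x = 2 *\<^sub>R ((1/2) *\<^sub>R (S x + Y (Y x)))"
      by simp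
    then show ?thesis
      by simp
  qed
  have root: "cinner (x - Y x) (y - Y y) = cinner x y - cinner (S x) y" for x y
  proof -
    have "cinner (x - Y x) (y - Y y) = cinner x y - 2 * cinner (Y x) y + cinner (Y (Y x)) y"
      by (simp add: cinner_diff_left cinner_diff_right Ysym)
    then show ?thesis
      by (simp add: YY cinner_diff_left scaleR_scaleC cinner_scaleC_left)
  qed
  define \<Gamma> where "\<Gamma> x = of_real c *\<^sub>C (A x - Y (A x))" for x
  have "cinner (\<Gamma> x) (\<Gamma> y) = (of_real c)\<^sup>2 * cinner (A x) (A y) - cinner (B x) (B y)" for x y
    using c(1) by (simp add: \<Gamma>_def cinner_scaleC_left cinner_scaleC_right root SA W'A
        right_diff_distrib power2_eq_square)
  then show ?thesis using c(1) by blast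
qed

section \<open>Resolvents and the open mapping argument\<close>

lemma neumann_inverse:
  fixes L :: "'a::banach \<Rightarrow>\<^sub>L 'a"
  assumes "norm L < 1"
  shows "\<exists>R. R - (L o\<^sub>L R) = id_blinfun \<and> R - (R o\<^sub>L L) = id_blinfun \<and> norm R \<le> 1 / (1 - norm L)"
proof -
  \<comment> \<open>A fixpoint of \<open>X \<mapsto> 1 + L X\<close> is a right inverse of
    \<open>1 - L\<close> by construction.\<close>
  have "\<exists>!X. id_blinfun + (L o\<^sub>L X) = X"
  proof (rule banach_fix_type)
    show "\<forall>X Y. dist (id_blinfun + (L o\<^sub>L X)) (id_blinfun + (L o\<^sub>L Y)) \<le> norm L * dist X Y"
    proof (intro allI)
      fix X Y :: "'a \<Rightarrow>\<^sub>L 'a"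
      have "(id_blinfun + (L o\<^sub>L X)) - (id_blinfun + (L o\<^sub>L Y)) = L o\<^sub>L (X - Y)"
        by (rule blinfun_eqI) (simp add: blinfun.add_left blinfun.diff_left blinfun.diff_right)
      then show "dist (id_blinfun + (L o\<^sub>L X)) (id_blinfun + (L o\<^sub>L Y)) \<le> norm L * dist X Y"
        by (simp add: dist_norm norm_blinfun_compose)
    qed
  qed (use assms in auto)
  then obtain R where R: "id_blinfun + (L o\<^sub>L R) = R" by blast
  have R_apply: "x + L (R x) = R x" for x
    using arg_cong[OF R, of "\<lambda>T. T x"] by (simp add: blinfun.add_left)
  have inj: "x = 0" if "L x = x" for x
  proof -
    have "norm x \<le> norm L * norm x"
      using norm_blinfun[of L x] that by simp
    then have "(1 - norm L) * norm x \<le> 0" by (simp add: algebra_simps)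
    then show ?thesis using assms by (simp add: mult_le_0_iff)
  qed
  have LR: "L (R v) = R v - v" for v
    using R_apply[of v] by (simp add: eq_diff_eq add.commute)
  have "R x - R (L x) = x" for x
  proof -
    \<comment> \<open>This vector is fixed by \<open>L\<close>, hence zero; so the right inverse is
      also a left inverse.\<close>
    have "R x - R (L x) - x = 0"
        by (rule inj) (simp add: blinfun.diff_right LR)
    then show ?thesis by simp
  qed
  moreover have "norm R \<le> 1 / (1 - norm L)"
  proof (rule norm_blinfun_bound)
    show "norm (R x) \<le> 1 / (1 - norm L) * norm x" for x
    proof -
      have "norm (R x) \<le> norm x + norm (L (R x))"
        by (metis R_apply norm_triangle_ineq)
      also have "\<dots> \<le> norm x + norm L * norm (R x)"
        by (simp add: norm_blinfun)
      finally have "(1 - norm L) * norm (R x) \<le> norm x" by (simp add: algebra_simps)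
      then show ?thesis using assms by (simp add: pos_le_divide_eq mult.commute)
    qed
  qed (use assms in simp)
  ultimately show ?thesis
    by (intro exI[of _ R] conjI blinfun_eqI) (simp_all add: blinfun.diff_left LR)
qed

text \<open>\<open>R\<close> inverts \<open>1 - L\<close>. The resolvent identity turns
  \<open>R y - R z\<close> into \<open>R y L(y - z) R z\<close>; using it twice leaves a remainder
  quadratic in \<open>y - z\<close>, with a constant uniform on \<open>U\<close> by
  \<open>bound\<close>.\<close>

lemma resolvent_has_derivative:
  fixes L :: "'z::real_normed_vector \<Rightarrow> 'a::real_normed_vector \<Rightarrow>\<^sub>L 'a"
    and R :: "'z \<Rightarrow> 'a \<Rightarrow>\<^sub>L 'a"
  assumes L: "bounded_linear L" and U: "open U" and z: "z \<in> U"
    and R1: "\<And>w. w \<in> U \<Longrightarrow> R w - (L w o\<^sub>L R w) = id_blinfun"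
    and R2: "\<And>w. w \<in> U \<Longrightarrow> R w - (R w o\<^sub>L L w) = id_blinfun"
    and bound: "\<And>w. w \<in> U \<Longrightarrow> norm (R w) \<le> B"
  shows "(R has_derivative (\<lambda>h. R z o\<^sub>L L h o\<^sub>L R z)) (at z)"
proof -
  interpret L: bounded_linear L by (rule L)
  have B: "0 \<le> B" using bound[OF z] norm_ge_zero order_trans by blast
  obtain K where K: "0 \<le> K" "\<And>h. norm (L h) \<le> K * norm h"
    using L.nonneg_bounded by (auto simp: mult.commute)
  have bl: "bounded_linear (\<lambda>h. R z o\<^sub>L L h o\<^sub>L R z)"
    by (rule bounded_linear_compose[OF bounded_bilinear.bounded_linear_left[OF bounded_bilinear_blinfun_compose]
          bounded_linear_compose[OF bounded_bilinear.bounded_linear_right[OF bounded_bilinear_blinfun_compose] L]])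
  obtain e where e: "0 < e" "ball z e \<subseteq> U"
    using U z open_contains_ball by blast
  have diff: "R y x - R z x = R y (L (y - z) (R z x))" if y: "y \<in> U" for x y
  proof -
    have 1: "R z x - L z (R z x) = x"
      using arg_cong[OF R1[OF z], of "\<lambda>T. T x"] by (simp add: blinfun.diff_left)
    have 2: "R y v - R y (L y v) = v" for v
      using arg_cong[OF R2[OF y], of "\<lambda>T. T v"] by (simp add: blinfun.diff_left)
    have "R y (R z x - L z (R z x)) = R y x"
      by (simp add: 1)
    then show ?thesis
      using 2[of "R z x"] by (simp add: blinfun.diff_left blinfun.diff_right L.diff algebra_simps)
  qed
  show ?thesis
  proof (rule has_derivativeI_sandwich[OF e(1) bl])
    fix y assume y: "y \<noteq> z" "dist y z < e"
    then have yU: "y \<in> U" using e by (auto simp: dist_commute)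
    let ?h = "y - z"
    have "R y - R z - (R z o\<^sub>L L ?h o\<^sub>L R z) = (R y o\<^sub>L L ?h o\<^sub>L R z) o\<^sub>L (L ?h o\<^sub>L R z)"
      by (rule blinfun_eqI) (simp add: blinfun.diff_left diff[OF yU])
    also have "norm \<dots> \<le> (B * (K * norm ?h) * B) * ((K * norm ?h) * B)"
      using bound[OF yU] bound[OF z] K B
      by (intro order_trans[OF norm_blinfun_compose] mult_mono mult_nonneg_nonneg) auto
    finally have "norm (R y - R z - (R z o\<^sub>L L ?h o\<^sub>L R z)) \<le> (B * K * B * K * B * norm ?h) * norm ?h"
      by (simp add: mult_ac)
    then show "norm (R y - R z - (R z o\<^sub>L L ?h o\<^sub>L R z)) / norm ?h \<le> B * K * B * K * B * norm ?h"
      using y by (simp add: pos_divide_le_eq)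
  next
    have "((\<lambda>y. B * K * B * K * B * norm (y - z)) \<longlongrightarrow> B * K * B * K * B * norm (z - z)) (at z)"
      by (intro tendsto_intros)
    then show "((\<lambda>y. B * K * B * K * B * norm (y - z)) \<longlongrightarrow> 0) (at z)" by simp
  qed
qed

text \<open>This is the open mapping theorem for \<open>(x, s) \<mapsto> M x + s\<close>: Baire
  category, then successive approximation. Only \<open>x\<close> is controlled in norm; the part in
  \<open>S\<close> is recovered at the end from closedness of \<open>S\<close>.\<close>

lemma open_mapping_complement:
  fixes M :: "'a::banach \<Rightarrow> 'b::banach"
  assumes M: "bounded_linear M" and S: "subspace S" "closed S"
    and surj: "\<And>y. \<exists>x. \<exists>s\<in>S. y = M x + s"
  shows "\<exists>C\<ge>0. \<forall>y. \<exists>x. y - M x \<in> S \<and> norm x \<le> C * norm y"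
proof -
  interpret M: bounded_linear M by fact
  define A where "A n = {M x + s | x s. norm x \<le> real n \<and> s \<in> S}" for n :: nat
  have "\<Union>(range (\<lambda>n. closure (A n))) = UNIV"
  proof -
    have "y \<in> (\<Union>n. closure (A n))" for y
    proof -
      obtain x s where "y = M x + s" "s \<in> S" using surj by blast
      moreover obtain n where "norm x \<le> real n" using real_arch_simple by blast
      ultimately have "y \<in> A n" by (auto simp: A_def)
      then show ?thesis using closure_subset by blast
    qed
    then show ?thesis by blast
  qed
  then have "euclidean interior_of \<Union>(range (\<lambda>n. closure (A n))) \<noteq> {}" by simp
  then have "\<exists>n. interior (closure (A n)) \<noteq> {}"
    using Baire_category_alt[of euclidean "range (\<lambda>n. closure (A n))"]
      completely_metrizable_space_euclidean by auto
  then obtain n y0 where "y0 \<in> interior (closure (A n))" by blast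
  then obtain r where r: "0 < r" "ball y0 r \<subseteq> closure (A n)"
    by (meson mem_interior)
  define C where "C = 4 * real n / r"
  have C: "0 \<le> C" using r by (simp add: C_def)
  have approx: "\<exists>x. \<exists>s\<in>S. norm x \<le> C * norm y \<and> norm (y - M x - s) \<le> norm y / 2" for y
  proof (cases "y = 0")
    case True
    then show ?thesis using S(1) by (intro exI[of _ 0] bexI[of _ 0]) (auto simp: M.zero subspace_0)
  next
    case False
    \<comment> \<open>\<open>t\<close> places \<open>y0 + t *\<^sub>R y\<close> at distance
      \<open>r / 2\<close> from \<open>y0\<close>. Approximants from \<open>A n\<close> at these two
      points, subtracted and divided by \<open>t\<close>, give \<open>v\<close> of norm at most
      \<open>2 * n / t = C * norm y\<close> and two errors of at most \<open>norm y / 4\<close>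
      each.\<close>
    define t where "t = r / (2 * norm y)"
    have t: "0 < t" using r False by (simp add: t_def)
    have "y0 \<in> closure (A n)" "y0 + t *\<^sub>R y \<in> closure (A n)"
      using r False by (auto simp: subset_iff dist_norm t_def)
    moreover have "0 < t * norm y / 4" using t False by simp
    ultimately obtain a b where ab: "a \<in> A n" "dist a y0 < t * norm y / 4"
        "b \<in> A n" "dist b (y0 + t *\<^sub>R y) < t * norm y / 4"
      unfolding closure_approachable by meson
    then obtain x s x' s' where xs: "a = M x + s" "norm x \<le> n" "s \<in> S"
        "b = M x' + s'" "norm x' \<le> n" "s' \<in> S"
      by (auto simp: A_def)
    define v where "v = (1 / t) *\<^sub>R (x' - x)"
    define q where "q = (1 / t) *\<^sub>R (s' - s)"
    have "q \<in> S" using xs S(1) by (simp add: q_def subspace_diff subspace_scale)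
    moreover have "norm v \<le> C * norm y"
    proof -
      have "norm (x' - x) \<le> 2 * real n"
        using norm_triangle_ineq4[of x' x] xs by simp
      then have "norm v \<le> (1 / t) * (2 * real n)"
        using t by (simp add: v_def divide_right_mono)
      also have "\<dots> = C * norm y" by (simp add: t_def C_def)
      finally show ?thesis .
    qed
    moreover have "norm (y - M v - q) \<le> norm y / 2"
    proof -
      have "y - M v - q = (1 / t) *\<^sub>R ((a - y0) - (b - (y0 + t *\<^sub>R y)))"
        using t by (simp add: v_def q_def xs M.scaleR M.diff algebra_simps)
      moreover have "norm ((a - y0) - (b - (y0 + t *\<^sub>R y))) \<le> t * norm y / 4 + t * norm y / 4"
        using norm_triangle_ineq4[of "a - y0" "b - (y0 + t *\<^sub>R y)"] ab by (simp add: dist_norm)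
      ultimately show ?thesis using t by (simp add: divide_simps mult.commute)
    qed
    ultimately show ?thesis by blast
  qed
  then obtain X T where XT: "\<And>y. T y \<in> S" "\<And>y. norm (X y) \<le> C * norm y"
      "\<And>y. norm (y - M (X y) - T y) \<le> norm y / 2"
    by metis
  \<comment> \<open>\<open>N y\<close> is the residue after one correction. It has at most half the
    norm of \<open>y\<close>, so the corrections are dominated by a geometric series with sum
    \<open>2 * C * norm y\<close>.\<close>
  define N where "N y = y - M (X y) - T y" for y
  have "\<exists>x. y - M x \<in> S \<and> norm x \<le> (2 * C) * norm y" for y
  proof -
    define f where "f k = X ((N ^^ k) y)" for k
    have N: "norm ((N ^^ k) y) \<le> norm y * (1/2) ^ k" for k
    proof (induction k)
      case (Suc k)
      then show ?case using XT(3)[of "(N ^^ k) y"] by (simp add: N_def[symmetric])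
    qed simp
    have nf: "norm (f k) \<le> (C * norm y) * (1/2) ^ k" for k
      using XT(2)[of "(N ^^ k) y"] mult_left_mono[OF N[of k] C] by (simp add: f_def mult.assoc)
    have geo: "(\<lambda>k. (C * norm y) * (1/2) ^ k) sums ((C * norm y) * (1 / (1 - 1/2)))"
      by (intro sums_mult geometric_sums) simp
    have sumf: "summable f"
      by (rule summable_comparison_test'[OF sums_summable[OF geo]]) (use nf in auto)
    define x where "x = suminf f"
    have "norm x \<le> (2 * C) * norm y"
    proof -
      have sn: "summable (\<lambda>k. norm (f k))"
        by (rule summable_comparison_test'[OF sums_summable[OF geo]]) (use nf in auto)
      have "norm x \<le> (\<Sum>k. norm (f k))"
        unfolding x_def by (rule summable_norm[OF sn])
      also have "\<dots> \<le> (\<Sum>k. (C * norm y) * (1/2) ^ k)"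
        by (rule suminf_le[OF _ sn sums_summable[OF geo]]) (rule nf)
      finally show ?thesis by (simp add: sums_unique[OF geo, symmetric])
    qed
    moreover have "y - M x \<in> S"
    proof (rule Lim_in_closed_set[OF S(2)])
      \<comment> \<open>Modulo \<open>S\<close>, the first \<open>m\<close> corrections account for
        all of \<open>y\<close> except the \<open>m\<close>-th residue.\<close>
      have part: "y - M (\<Sum>k<m. f k) - (N ^^ m) y \<in> S" for m
      proof (induction m)
        case 0
        then show ?case using S(1) by (simp add: M.zero subspace_0)
      next
        case (Suc m)
        have "y - M (\<Sum>k<Suc m. f k) - (N ^^ Suc m) y = (y - M (\<Sum>k<m. f k) - (N ^^ m) y) + T ((N ^^ m) y)"
          by (simp add: M.add f_def N_def)
        then show ?case using subspace_add[OF S(1) Suc XT(1)] by (simp only:)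
      qed
      then show "\<forall>\<^sub>F m in sequentially. y - M (\<Sum>k<m. f k) - (N ^^ m) y \<in> S" by simp
      have "(\<lambda>m. norm y * (1/2) ^ m) \<longlonglongrightarrow> norm y * 0"
        by (intro tendsto_mult tendsto_const LIMSEQ_power_zero) simp
      then have "(\<lambda>m. norm y * (1/2) ^ m) \<longlonglongrightarrow> 0"
        unfolding mult_zero_right .
      then have "(\<lambda>m. (N ^^ m) y) \<longlonglongrightarrow> 0"
        by (rule Lim_null_comparison[rotated]) (intro always_eventually allI N)
      moreover have "(\<lambda>m. M (\<Sum>k<m. f k)) \<longlonglongrightarrow> M x"
        using sumf unfolding x_def by (intro M.tendsto summable_LIMSEQ)
      ultimately have "(\<lambda>m. y - M (\<Sum>k<m. f k) - (N ^^ m) y) \<longlonglongrightarrow> y - M x - 0"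
        by (intro tendsto_diff tendsto_const)
      then show "(\<lambda>m. y - M (\<Sum>k<m. f k) - (N ^^ m) y) \<longlonglongrightarrow> y - M x" by simp
    qed simp
    ultimately show ?thesis by blast
  qed
  then show ?thesis using C by (intro exI[of _ "2 * C"]) simp
qed

subsection \<open>Vector-valued Drury-Arveson spaces\<close>

lemma cinner_eqI_right: "x = y" if "\<And>z. cinner z x = cinner z (y::'a::complex_inner)"
  by (rule cinner_eqI) (metis cinner_commute that)

text \<open>The squared norms differ by that of the same combination of the \<open>g i\<close>. This
  turns kernel identities into the domination hypothesis of
  \<open>dominated_family_adjoint\<close>.\<close>

lemma lincomb_norm_le_of_gram:
  fixes u :: "'i \<Rightarrow> 'a::complex_inner" and v :: "'i \<Rightarrow> 'b::complex_inner" and g :: "'i \<Rightarrow> 'c::complex_inner"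
  assumes "\<And>i j. i \<in> I \<Longrightarrow> j \<in> I \<Longrightarrow> cinner (u i) (u j) = cinner (v i) (v j) + cinner (g i) (g j)"
  shows "norm (\<Sum>i\<in>I. c i *\<^sub>C v i) \<le> norm (\<Sum>i\<in>I. c i *\<^sub>C u i)"
proof -
  have "complex_of_real ((norm (\<Sum>i\<in>I. c i *\<^sub>C u i))\<^sup>2)
      = complex_of_real ((norm (\<Sum>i\<in>I. c i *\<^sub>C v i))\<^sup>2) + complex_of_real ((norm (\<Sum>i\<in>I. c i *\<^sub>C g i))\<^sup>2)"
    unfolding norm_lincomb_square sum.distrib[symmetric]
    by (intro sum.cong refl) (simp add: assms distrib_left)
  then have "(norm (\<Sum>i\<in>I. c i *\<^sub>C u i))\<^sup>2
      = (norm (\<Sum>i\<in>I. c i *\<^sub>C v i))\<^sup>2 + (norm (\<Sum>i\<in>I. c i *\<^sub>C g i))\<^sup>2"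
    unfolding of_real_add[symmetric] of_real_eq_iff .
  then show ?thesis
    by (simp add: power2_le_imp_le)
qed

lemma norm_sum_scaleC_vec_le:
  fixes z :: "complex ^ 'n" and v :: "'a::complex_inner ^ 'n"
  shows "norm (\<Sum>i\<in>UNIV. z $ i *\<^sub>C v $ i) \<le> norm z * norm v"
proof -
  have "norm (\<Sum>i\<in>UNIV. z $ i *\<^sub>C v $ i) \<le> (\<Sum>i\<in>UNIV. \<bar>norm (z $ i)\<bar> * \<bar>norm (v $ i)\<bar>)"
    by (rule order_trans[OF norm_sum]) (simp add: norm_scaleC)
  also have "\<dots> \<le> norm z * norm v"
    unfolding norm_vec_def by (rule L2_set_mult_ineq)
  finally show ?thesis .
qed

lemma norm_snd_le_norm: "norm (snd p) \<le> norm (p :: 'a::real_normed_vector \<times> 'b::real_normed_vector)"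
  by (metis norm_snd_le prod.collapse)

lemma norm_Pair_0: "norm (0 :: 'a::real_normed_vector, y) = norm (y :: 'b::real_normed_vector)"
  by (simp add: norm_Pair)

section \<open>The Drury-Arveson kernel and its Schur products\<close>

lemma drury_arveson_kernel_cinner: "drury_arveson_kernel z w = 1 / (1 - cinner z w)"
  by (simp add: drury_arveson_kernel_def cinner_vec_def cinner_complex_def)

lemma norm_cinner_ball:
  fixes z w :: "complex ^ 'n"
  assumes "z \<in> ball 0 1" "w \<in> ball 0 1"
  shows "norm (cinner z w) < 1"
proof -
  have "norm z * norm w \<le> 1 * norm w"
    using assms by (intro mult_right_mono) auto
  then show ?thesis
    using norm_cinner_le[of z w] assms by simp
qed

lemma drury_arveson_kernel_eq:
  assumes "z \<in> ball 0 1" "w \<in> ball 0 1"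
  shows "cinner z w * drury_arveson_kernel z w = drury_arveson_kernel z w - 1"
    "(1 - cinner z w) * drury_arveson_kernel z w = 1"
proof -
  have "cinner z w \<noteq> 1"
    using norm_cinner_ball[OF assms] by auto
  then show "cinner z w * drury_arveson_kernel z w = drury_arveson_kernel z w - 1"
    "(1 - cinner z w) * drury_arveson_kernel z w = 1"
    by (simp_all add: drury_arveson_kernel_cinner field_simps)
qed

lemma drury_arveson_kernel_0 [simp]: "drury_arveson_kernel z 0 = 1"
  by (simp add: drury_arveson_kernel_cinner)

text \<open>The kernel is the geometric series in \<open>cinner (p j) (p i)\<close>, and entrywise
  multiplication by this Gram matrix preserves positivity of the form.\<close>

lemma drury_arveson_schur:
  fixes p :: "'i \<Rightarrow> complex ^ 'n" and a :: "'i \<Rightarrow> 'i \<Rightarrow> complex"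
  assumes p: "\<And>i. i \<in> I \<Longrightarrow> p i \<in> ball 0 1"
    and psd: "\<And>c. 0 \<le> Re (\<Sum>i\<in>I. \<Sum>j\<in>I. c i * cnj (c j) * a i j)"
  shows "0 \<le> Re (\<Sum>i\<in>I. \<Sum>j\<in>I. c i * cnj (c j) * (drury_arveson_kernel (p j) (p i) * a i j))"
proof -
  have pow: "0 \<le> Re (\<Sum>i\<in>I. \<Sum>j\<in>I. c i * cnj (c j) * (cinner (p j) (p i) ^ m * a i j))" for m c
  proof (induction m arbitrary: c)
    case 0
    then show ?case using psd by simp
  next
    case (Suc m)
    \<comment> \<open>Expanding one inner product over the coordinates \<open>l\<close> and moving
      \<open>cnj (p i $ l)\<close> into the coefficients gives a sum of instances for
      \<open>m\<close>; this is why \<open>c\<close> is arbitrary in the induction.\<close>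
    have "(\<Sum>i\<in>I. \<Sum>j\<in>I. c i * cnj (c j) * (cinner (p j) (p i) ^ Suc m * a i j))
        = (\<Sum>i\<in>I. \<Sum>j\<in>I. \<Sum>l\<in>UNIV. (c i * cnj (p i $ l)) * cnj (c j * cnj (p j $ l)) *
            (cinner (p j) (p i) ^ m * a i j))"
      by (intro sum.cong refl)
        (simp add: cinner_vec_def[of "p _"] cinner_complex_def sum_distrib_left sum_distrib_right mult_ac)
    also have "\<dots> = (\<Sum>l\<in>UNIV. \<Sum>i\<in>I. \<Sum>j\<in>I. (c i * cnj (p i $ l)) * cnj (c j * cnj (p j $ l)) *
            (cinner (p j) (p i) ^ m * a i j))"
      by (subst sum.swap, subst sum.swap[of _ _ UNIV]) (rule refl)
    finally show ?case
      by (simp only: Re_sum[of _ UNIV]) (intro sum_nonneg Suc.IH)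
  qed
  have "(\<lambda>m. \<Sum>i\<in>I. \<Sum>j\<in>I. c i * cnj (c j) * (cinner (p j) (p i) ^ m * a i j)) sums
      (\<Sum>i\<in>I. \<Sum>j\<in>I. c i * cnj (c j) * (drury_arveson_kernel (p j) (p i) * a i j))"
    unfolding drury_arveson_kernel_cinner
    by (intro sums_sum sums_mult sums_mult2 geometric_sums norm_cinner_ball p)
  from sums_Re[OF this] show ?thesis
    by (rule sums_le[OF _ sums_zero, rotated]) (rule pow)
qed

text \<open>\<open>\<kappa> w \<eta>\<close> stands for the scalar kernel function at
  \<open>w\<close> tensored with \<open>\<eta>\<close>. The later arguments reach the tensor product
  only through these three properties.\<close>

locale vector_drury_arveson =
  fixes ev :: "'t::chilbert_space \<Rightarrow> complex ^ 'n \<Rightarrow> 'e::chilbert_space"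
    and \<kappa> :: "complex ^ 'n \<Rightarrow> 'e \<Rightarrow> 't"
  assumes function_space: "function_space (ball 0 1) ev"
    and ev_kernel: "\<And>w z \<eta>. w \<in> ball 0 1 \<Longrightarrow> z \<in> ball 0 1 \<Longrightarrow>
      ev (\<kappa> w \<eta>) z = drury_arveson_kernel z w *\<^sub>C \<eta>"
    and reproducing: "\<And>w F \<eta>. w \<in> ball 0 1 \<Longrightarrow> cinner F (\<kappa> w \<eta>) = cinner (ev F w) \<eta>"
begin

lemma clinear_ev: "z \<in> ball 0 1 \<Longrightarrow> clinear_map (\<lambda>F. ev F z)"
  using function_space by (auto simp: function_space_def)

lemmas ev_simps = clinear_mapD[OF clinear_ev]

lemma function_eqI:
  assumes "\<And>z. z \<in> ball 0 1 \<Longrightarrow> ev F z = ev G z"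
  shows "F = G"
proof -
  have "\<forall>z\<in>ball 0 1. ev (F - G) z = 0"
    using assms by (simp add: ev_simps)
  then show ?thesis
    using function_space unfolding function_space_def by (metis eq_iff_diff_eq_0)
qed

lemma reproducing_left: "w \<in> ball 0 1 \<Longrightarrow> cinner (\<kappa> w \<eta>) F = cinner \<eta> (ev F w)"
  by (metis cinner_commute reproducing)

lemma kernel_gram:
  "w \<in> ball 0 1 \<Longrightarrow> z \<in> ball 0 1 \<Longrightarrow>
    cinner (\<kappa> w \<eta>) (\<kappa> z \<zeta>) = drury_arveson_kernel z w * cinner \<eta> \<zeta>"
  by (simp add: reproducing ev_kernel cinner_scaleC_left)

lemma clinear_kernel: "w \<in> ball 0 1 \<Longrightarrow> clinear_map (\<kappa> w)"
  unfolding clinear_map_def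
  by (intro conjI allI; rule cinner_eqI)
    (simp_all add: reproducing_left cinner_add_left cinner_scaleC_left)

text \<open>The kernel at 0 is the constant 1, so \<open>\<kappa> 0\<close> embeds the coefficients
  as constant functions, isometrically.\<close>

lemma norm_kernel_0: "norm (\<kappa> 0 \<eta>) = norm \<eta>"
proof -
  have "complex_of_real ((norm (\<kappa> 0 \<eta>))\<^sup>2) = complex_of_real ((norm \<eta>)\<^sup>2)"
    unfolding cinner_self[symmetric] by (simp add: kernel_gram)
  then have "(norm (\<kappa> 0 \<eta>))\<^sup>2 = (norm \<eta>)\<^sup>2"
    unfolding of_real_eq_iff .
  then show ?thesis by (rule power2_eq_imp_eq) simp_all
qed

text \<open>Cauchy-Schwarz in the reproducing property at \<open>\<eta> = ev F w\<close>, with the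
  norm of the kernel function read off from its Gram value.\<close>

lemma bounded_ev:
  assumes w: "w \<in> ball 0 1"
  shows "bounded_linear (\<lambda>F. ev F w)"
proof -
  define C where "C = sqrt (Re (drury_arveson_kernel w w))"
  have nk: "norm (\<kappa> w \<eta>) \<le> C * norm \<eta>" for \<eta>
  proof -
    have "complex_of_real ((norm (\<kappa> w \<eta>))\<^sup>2) = drury_arveson_kernel w w * complex_of_real ((norm \<eta>)\<^sup>2)"
      unfolding cinner_self[symmetric] using w by (simp add: kernel_gram)
    then have "Re (complex_of_real ((norm (\<kappa> w \<eta>))\<^sup>2)) = Re (drury_arveson_kernel w w * complex_of_real ((norm \<eta>)\<^sup>2))"
      by (rule arg_cong)
    then have "norm (\<kappa> w \<eta>) = sqrt (Re (drury_arveson_kernel w w) * (norm \<eta>)\<^sup>2)"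
      by (intro real_sqrt_unique[symmetric]) (simp_all del: of_real_power)
    then show ?thesis
      by (simp add: C_def real_sqrt_mult)
  qed
  have "norm (ev F w) \<le> C * norm F" for F
  proof -
    have "(norm (ev F w))\<^sup>2 = norm (cinner F (\<kappa> w (ev F w)))"
      using w by (simp add: reproducing cinner_self norm_power)
    also have "\<dots> \<le> norm F * (C * norm (ev F w))"
      by (rule order_trans[OF norm_cinner_le]) (intro mult_left_mono nk norm_ge_zero)
    finally have le: "norm (ev F w) * norm (ev F w) \<le> (C * norm F) * norm (ev F w)"
      by (simp add: power2_eq_square mult_ac)
    show ?thesis
    proof (cases "ev F w = 0")
      case True
      have "0 \<le> C * norm F"
        using norm_ge_zero order_trans[OF _ mult_right_mono[OF nk[of "ev F w"]]] w
        by (cases "F = 0") (simp_all add: C_def drury_arveson_kernel_cinner cinner_self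
            Re_divide power_le_one)
      then show ?thesis using True by simp
    next
      case False
      then show ?thesis using le by (simp add: mult_le_cancel_right)
    qed
  qed
  then have "bounded_clinear (\<lambda>F. ev F w) C"
    using clinear_ev[OF w] by (simp add: bounded_clinear_def)
  then show ?thesis by (rule bounded_clinear_imp_bounded_linear)
qed

text \<open>The adjoint of the row must send \<open>\<kappa> w \<eta>\<close> to the column with
  entries \<open>cnj (w $ i) *\<^sub>C \<kappa> w \<eta>\<close>. The two Gram matrices differ by
  that of the coefficients, because the kernel minus \<open>cinner z w\<close> times the kernel is
  1; so this map is contractive.\<close>

lemma row_multiplication:
  "\<exists>W :: 't ^ 'n \<Rightarrow> 't. bounded_clinear W 1 \<and>
    (\<forall>G. \<forall>z\<in>ball 0 1. ev (W G) z = (\<Sum>i\<in>UNIV. z $ i *\<^sub>C ev (G $ i) z))"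
proof -
  define u where "u q = \<kappa> (fst q) (snd q)" for q
  define v :: "(complex ^ 'n) \<times> 'e \<Rightarrow> 't ^ 'n"
    where "v q = (\<chi> i. cnj (fst q $ i) *\<^sub>C u q)" for q
  let ?A = "ball 0 1 \<times> UNIV :: ((complex ^ 'n) \<times> 'e) set"
  have gram: "cinner (u q) (u r) = cinner (v q) (v r) + cinner (snd q) (snd r)"
    if "q \<in> ?A" "r \<in> ?A" for q r
  proof -
    have qr: "fst q \<in> ball 0 1" "fst r \<in> ball 0 1" using that by auto
    have "cinner (v q) (v r) = cinner (fst r) (fst q) * cinner (u q) (u r)"
      by (simp add: v_def cinner_vec_def cinner_complex_def cinner_scaleC_left cinner_scaleC_right
          sum_distrib_left sum_distrib_right mult_ac)
    also have "cinner (u q) (u r) = drury_arveson_kernel (fst r) (fst q) * cinner (snd q) (snd r)"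
      unfolding u_def by (rule kernel_gram[OF qr])
    finally show ?thesis
      unfolding u_def kernel_gram[OF qr] mult.assoc[symmetric] drury_arveson_kernel_eq(1)[OF qr(2,1)]
      by (simp add: left_diff_distrib)
  qed
  have "norm (\<Sum>q\<in>I. c q *\<^sub>C v q) \<le> 1 * norm (\<Sum>q\<in>I. c q *\<^sub>C u q)" if "I \<subseteq> ?A" for I c
    unfolding mult_1 by (rule lincomb_norm_le_of_gram[where g = snd]) (use that in \<open>auto intro!: gram\<close>)
  then obtain W where W: "bounded_clinear W 1" "\<And>q G. q \<in> ?A \<Longrightarrow> cinner (u q) (W G) = cinner (v q) G"
    using dominated_family_adjoint[of ?A v 1 u] by fastforce
  have "ev (W G) z = (\<Sum>i\<in>UNIV. z $ i *\<^sub>C ev (G $ i) z)" if z: "z \<in> ball 0 1" for G z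
  proof (rule cinner_eqI_right)
    fix \<eta>
    have "cinner \<eta> (ev (W G) z) = cinner (u (z, \<eta>)) (W G)"
      using z by (simp add: u_def reproducing_left)
    also have "\<dots> = cinner (v (z, \<eta>)) G"
      using z by (intro W) simp
    also have "\<dots> = cinner \<eta> (\<Sum>i\<in>UNIV. z $ i *\<^sub>C ev (G $ i) z)"
      using z by (simp add: v_def u_def cinner_vec_def cinner_scaleC_left cinner_scaleC_right
          cinner_sum_right reproducing_left)
    finally show "cinner \<eta> (ev (W G) z) = cinner \<eta> (\<Sum>i\<in>UNIV. z $ i *\<^sub>C ev (G $ i) z)" .
  qed
  then show ?thesis using W(1) by blast
qed

lemma coordinate_multiplication:
  "\<exists>g. \<forall>z\<in>ball 0 1. ev g z = z $ i *\<^sub>C ev f z"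
proof -
  obtain W :: "'t ^ 'n \<Rightarrow> 't"
    where W: "\<And>G z. z \<in> ball 0 1 \<Longrightarrow> ev (W G) z = (\<Sum>i\<in>UNIV. z $ i *\<^sub>C ev (G $ i) z)"
    using row_multiplication by blast
  \<comment> \<open>The row is applied to the vector with \<open>f\<close> in slot \<open>i\<close>
    and 0 elsewhere.\<close>
  have "(\<Sum>j\<in>UNIV. z $ j *\<^sub>C ev (axis i f $ j) z) = z $ i *\<^sub>C ev f z" if "z \<in> ball 0 1" for z
  proof -
    have "(\<Sum>j\<in>UNIV. z $ j *\<^sub>C ev (axis i f $ j) z) = (\<Sum>j\<in>UNIV. if j = i then z $ i *\<^sub>C ev f z else 0)"
      using that by (intro sum.cong) (auto simp: axis_def ev_simps)
    then show ?thesis by simp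
  qed
  then show ?thesis using W by (intro exI[of _ "W (axis i f)"]) simp
qed

text \<open>The row of coordinate multiplications is a partial isometry onto the functions vanishing at \<open>0\<close>,
  and \<open>G\<close> is its adjoint applied to \<open>F\<close>.\<close>

lemma gleason_contractive:
  "\<exists>G :: 't ^ 'n. norm G \<le> norm F \<and>
    (\<forall>z\<in>ball 0 1. ev F z = ev F 0 + (\<Sum>i\<in>UNIV. z $ i *\<^sub>C ev (G $ i) z))"
proof -
  obtain W :: "'t ^ 'n \<Rightarrow> 't" where bW: "bounded_clinear W 1"
    and W: "\<And>G z. z \<in> ball 0 1 \<Longrightarrow> ev (W G) z = (\<Sum>i\<in>UNIV. z $ i *\<^sub>C ev (G $ i) z)"
    using row_multiplication by blast
  obtain W' where bW': "bounded_clinear W' 1" and W': "\<And>x y. cinner (W x) y = cinner x (W' y)"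
    using adjoint_exists[OF bW] by auto
  have "ev F z = ev F 0 + (\<Sum>i\<in>UNIV. z $ i *\<^sub>C ev (W' F $ i) z)" if z: "z \<in> ball 0 1" for z
  proof (rule cinner_eqI_right)
    fix \<eta>
    \<comment> \<open>The row sends \<open>v\<close> to
      \<open>\<kappa> z \<eta> - \<kappa> 0 \<eta>\<close>, and pairing this with \<open>F\<close>
      yields the increment of \<open>F\<close> from 0 to \<open>z\<close>.\<close>
    define v :: "'t ^ 'n" where "v = (\<chi> i. cnj (z $ i) *\<^sub>C \<kappa> z \<eta>)"
    have "W v = \<kappa> z \<eta> - \<kappa> 0 \<eta>"
    proof (rule function_eqI)
      fix x :: "complex ^ 'n" assume x: "x \<in> ball 0 1"
      have "ev (W v) x = (\<Sum>i\<in>UNIV. (x $ i * cnj (z $ i) * drury_arveson_kernel x z) *\<^sub>C \<eta>)"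
        using x z by (simp add: W v_def ev_simps ev_kernel scaleC_scaleC mult.assoc)
      also have "\<dots> = (cinner x z * drury_arveson_kernel x z) *\<^sub>C \<eta>"
        unfolding cinner_vec_def cinner_complex_def sum_distrib_right
        by (rule scaleC_sum_left[symmetric])
      also have "\<dots> = ev (\<kappa> z \<eta> - \<kappa> 0 \<eta>) x"
        unfolding drury_arveson_kernel_eq(1)[OF x z]
        using x z by (simp add: ev_simps ev_kernel scaleC_add_left[of _ "- 1", simplified] scaleC_minus_left)
      finally show "ev (W v) x = ev (\<kappa> z \<eta> - \<kappa> 0 \<eta>) x" .
    qed
    have "cinner \<eta> (\<Sum>i\<in>UNIV. z $ i *\<^sub>C ev (W' F $ i) z) = cinner v (W' F)"
      using z by (simp add: v_def cinner_vec_def cinner_sum_right cinner_scaleC_left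
          cinner_scaleC_right reproducing_left)
    also have "\<dots> = cinner (\<kappa> z \<eta> - \<kappa> 0 \<eta>) F"
      by (simp add: W'[symmetric] \<open>W v = _\<close>)
    also have "\<dots> = cinner \<eta> (ev F z) - cinner \<eta> (ev F 0)"
      using z by (simp add: cinner_diff_left reproducing_left)
    finally show "cinner \<eta> (ev F z) = cinner \<eta> (ev F 0 + (\<Sum>i\<in>UNIV. z $ i *\<^sub>C ev (W' F $ i) z))"
      by (simp add: cinner_add_right)
  qed
  moreover have "norm (W' F) \<le> norm F"
    using bW' unfolding bounded_clinear_def mult_1 by blast
  ultimately show ?thesis by blast
qed

text \<open>A bounded module map is a multiplication operator: the defect \<open>\<delta>\<close> of the claimed identity
  satisfies \<open>\<delta> F = (\<Sum>i. w\<^sub>i \<delta> G\<^sub>i)\<close> for the Gleason decomposition of \<open>F\<close>, so iterating gives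
  \<open>norm (\<delta> F) \<le> D (norm w)\<^sup>m norm F\<close> for all \<open>m\<close>.\<close>

lemma module_map_ev:
  fixes P :: "'t \<Rightarrow> 't"
  assumes P: "bounded_clinear P C"
    and module: "\<And>i f g z. (\<And>z. z \<in> ball 0 1 \<Longrightarrow> ev g z = z $ i *\<^sub>C ev f z) \<Longrightarrow> z \<in> ball 0 1 \<Longrightarrow>
      ev (P g) z = z $ i *\<^sub>C ev (P f) z"
    and w: "w \<in> ball 0 1"
  shows "ev (P F) w = ev (P (\<kappa> 0 (ev F w))) w"
proof -
  have linP: "clinear_map P" using P by (simp add: bounded_clinear_def)
  have lin\<kappa>: "clinear_map (\<kappa> 0)" by (rule clinear_kernel) simp
  \<comment> \<open>\<open>Q\<close> is the candidate symbol at \<open>w\<close>, read off from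
    constant functions.\<close>
  define Q where "Q \<eta> = ev (P (\<kappa> 0 \<eta>)) w" for \<eta>
  define \<delta> where "\<delta> F = ev (P F) w - Q (ev F w)" for F
  have linQ: "clinear_map Q"
    unfolding Q_def by (intro clinear_map_compose[OF clinear_ev[OF w] clinear_map_compose[OF linP lin\<kappa>]])
  have "bounded_clinear (\<kappa> 0) 1"
    using lin\<kappa> by (simp add: bounded_clinear_def norm_kernel_0)
  then have "bounded_linear Q"
    unfolding Q_def
    by (intro bounded_linear_compose[OF bounded_ev[OF w]] bounded_linear_compose[OF
        bounded_clinear_imp_bounded_linear[OF P]] bounded_clinear_imp_bounded_linear)
  then have "bounded_linear \<delta>"
    unfolding \<delta>_def
    by (intro bounded_linear_sub bounded_linear_compose[OF bounded_ev[OF w]]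
        bounded_linear_compose[OF _ bounded_ev[OF w]] bounded_clinear_imp_bounded_linear[OF P])
  then obtain D where D: "0 \<le> D" "\<And>F. norm (\<delta> F) \<le> D * norm F"
    using bounded_linear.nonneg_bounded by (metis mult.commute)
  have rec: "\<exists>G :: 't ^ 'n. norm G \<le> norm F \<and> \<delta> F = (\<Sum>i\<in>UNIV. w $ i *\<^sub>C \<delta> (G $ i))" for F
  proof -
    obtain G :: "'t ^ 'n" where nG: "norm G \<le> norm F"
      and G: "\<And>z. z \<in> ball 0 1 \<Longrightarrow> ev F z = ev F 0 + (\<Sum>i\<in>UNIV. z $ i *\<^sub>C ev (G $ i) z)"
      using gleason_contractive by blast
    have "\<forall>i. \<exists>g. \<forall>z\<in>ball 0 1. ev g z = z $ i *\<^sub>C ev (G $ i) z"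
      using coordinate_multiplication by blast
    then obtain g where g: "\<And>i z. z \<in> ball 0 1 \<Longrightarrow> ev (g i) z = z $ i *\<^sub>C ev (G $ i) z"
      by metis
    \<comment> \<open>The constant term contributes nothing to \<open>\<delta>\<close>, by the
      choice of \<open>Q\<close>; the assumption \<open>module\<close> handles the coordinate
      multiples.\<close>
    have "F = \<kappa> 0 (ev F 0) + (\<Sum>i\<in>UNIV. g i)"
      by (rule function_eqI, subst G) (simp_all add: ev_simps g ev_kernel)
    have Pg: "ev (P (g i)) w = w $ i *\<^sub>C ev (P (G $ i)) w" for i
      by (rule module[OF g w])
    from \<open>F = _\<close> have "ev (P F) w = ev (P (\<kappa> 0 (ev F 0) + (\<Sum>i\<in>UNIV. g i))) w"
      by (rule arg_cong)
    also have "\<dots> = Q (ev F 0) + (\<Sum>i\<in>UNIV. w $ i *\<^sub>C ev (P (G $ i)) w)"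
      using w by (simp add: clinear_mapD[OF linP] ev_simps Q_def Pg)
    finally have "\<delta> F = (\<Sum>i\<in>UNIV. w $ i *\<^sub>C \<delta> (G $ i))"
      unfolding \<delta>_def by (subst G[OF w])
        (simp add: clinear_mapD[OF linQ] scaleC_diff_right sum_subtractf)
    then show ?thesis using nG by blast
  qed
  have bound: "norm (\<delta> F) \<le> (D * norm w ^ m) * norm F" for m F
  proof (induction m arbitrary: F)
    case 0
    then show ?case using D(2) by simp
  next
    case (Suc m)
    obtain G :: "'t ^ 'n" where nG: "norm G \<le> norm F" and G: "\<delta> F = (\<Sum>i\<in>UNIV. w $ i *\<^sub>C \<delta> (G $ i))"
      using rec by blast
    have "norm (\<delta> F) \<le> (\<Sum>i\<in>UNIV. norm (w $ i) * norm (\<delta> (G $ i)))"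
      unfolding G by (rule order_trans[OF norm_sum]) (simp add: norm_scaleC)
    also have "\<dots> \<le> (\<Sum>i\<in>UNIV. norm (w $ i) * ((D * norm w ^ m) * norm (G $ i)))"
      by (intro sum_mono mult_left_mono Suc.IH norm_ge_zero)
    also have "\<dots> = (D * norm w ^ m) * (\<Sum>i\<in>UNIV. \<bar>norm (w $ i)\<bar> * \<bar>norm (G $ i)\<bar>)"
      by (simp add: sum_distrib_left mult_ac)
    \<comment> \<open>Cauchy-Schwarz over the coordinates; each round gains one factor
      \<open>norm w\<close>.\<close>
    also have "\<dots> \<le> (D * norm w ^ m) * (norm w * norm G)"
      unfolding norm_vec_def[of w] norm_vec_def[of G]
      by (intro mult_left_mono L2_set_mult_ineq mult_nonneg_nonneg zero_le_power D(1) L2_set_nonneg)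
    also have "\<dots> \<le> (D * norm w ^ m) * (norm w * norm F)"
      by (intro mult_left_mono nG mult_nonneg_nonneg zero_le_power D(1) norm_ge_zero)
    finally show ?case by (simp add: mult_ac)
  qed
  have "(\<lambda>m. (D * norm w ^ m) * norm F) \<longlonglongrightarrow> (D * 0) * norm F"
    using w by (intro tendsto_intros LIMSEQ_power_zero) simp
  then have "norm (\<delta> F) \<le> (D * 0) * norm F"
    by (rule LIMSEQ_le_const) (use bound in blast)
  then show ?thesis
    by (simp add: \<delta>_def Q_def)
qed

end

text \<open>The kernels are \<open>t (k w) \<eta>\<close>. Their reproducing property is immediate
  on elementary tensors and passes to the closed span by boundedness of evaluation.\<close>

lemma vector_drury_arveson_exists:
  fixes ev :: "'h::chilbert_space \<Rightarrow> complex ^ 'n \<Rightarrow> complex"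
    and evT :: "'t::chilbert_space \<Rightarrow> complex ^ 'n \<Rightarrow> 'e::chilbert_space"
  assumes "drury_arveson ev" and tensor: "function_tensor (ball 0 1) ev evT"
  shows "\<exists>\<kappa>. vector_drury_arveson evT \<kappa>"
proof -
  have "\<forall>w\<in>ball 0 1. \<exists>kw. (\<forall>z\<in>ball 0 1. ev kw z = drury_arveson_kernel z w) \<and> (\<forall>f. cinner f kw = ev f w)"
    using assms(1) by (auto simp: drury_arveson_def rkhs_def)
  then obtain k where k: "\<And>w z. w \<in> ball 0 1 \<Longrightarrow> z \<in> ball 0 1 \<Longrightarrow> ev (k w) z = drury_arveson_kernel z w"
      "\<And>w f. w \<in> ball 0 1 \<Longrightarrow> cinner f (k w) = ev f w"
    by metis
  have fs: "function_space (ball 0 1) evT"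
    and bd: "\<And>z. z \<in> ball 0 1 \<Longrightarrow> \<exists>C. \<forall>F. norm (evT F z) \<le> C * norm F"
    using tensor by (auto simp: function_tensor_def)
  obtain t where evt: "\<And>f \<eta> z. z \<in> ball 0 1 \<Longrightarrow> evT (t f \<eta>) z = ev f z *\<^sub>C \<eta>"
    and ct: "\<And>f \<eta> g \<zeta>. cinner (t f \<eta>) (t g \<zeta>) = cinner f g * cinner \<eta> \<zeta>"
    and dense: "closure (span {t f \<eta> | f \<eta>. True}) = UNIV"
    using tensor unfolding function_tensor_def by blast
  have "cinner F (t (k w) \<eta>) = cinner (evT F w) \<eta>" if w: "w \<in> ball 0 1" for w F \<eta>
  proof -
    obtain C where "\<forall>F. norm (evT F w) \<le> C * norm F" using bd[OF w] by blast
    moreover have "clinear_map (\<lambda>F. evT F w)"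
      using fs w by (simp add: function_space_def)
    ultimately have bl: "bounded_linear (\<lambda>F. evT F w)"
      using bounded_clinear_imp_bounded_linear[of "\<lambda>F. evT F w" C] by (simp add: bounded_clinear_def)
    let ?S = "{F. cinner F (t (k w) \<eta>) = cinner (evT F w) \<eta>}"
    have "closed ?S"
      by (intro closed_Collect_eq continuous_intros linear_continuous_on bl)
    moreover have "subspace ?S"
      using bl by (auto simp: subspace_def cinner_add_left linear_simps scaleR_scaleC
          cinner_scaleC_left linear_add[OF bounded_linear.linear[OF bl]]
          linear_cmul[OF bounded_linear.linear[OF bl], unfolded scaleR_scaleC]
          linear_0[OF bounded_linear.linear[OF bl]])
    moreover have "{t f \<zeta> | f \<zeta>. True} \<subseteq> ?S"
      using w by (auto simp: ct k evt cinner_scaleC_left)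
    ultimately have "closure (span {t f \<eta> | f \<eta>. True}) \<subseteq> ?S"
      by (intro closure_minimal span_minimal)
    then show ?thesis using dense by auto
  qed
  then have "vector_drury_arveson evT (\<lambda>w \<eta>. t (k w) \<eta>)"
    using fs by unfold_locales (simp_all add: evt k)
  then show ?thesis by blast
qed

text \<open>On kernel functions at \<open>w\<close> the adjoint of a multiplication operator acts on
  the coefficient alone, so operator relations tested there become pointwise relations between
  symbols.\<close>

lemma adjoint_kernel:
  assumes "vector_drury_arveson evE \<kappa>E" and "vector_drury_arveson evF \<kappa>F"
    and M: "\<And>f. evF (M f) w = T (evE f w)" and M': "\<And>x y. cinner (M x) y = cinner x (M' y)"
    and T': "\<And>x y. cinner (T x) y = cinner x (T' y)" and w: "w \<in> ball 0 1"
  shows "M' (\<kappa>F w \<eta>) = \<kappa>E w (T' \<eta>)"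
proof (rule cinner_eqI_right)
  fix x
  show "cinner x (M' (\<kappa>F w \<eta>)) = cinner x (\<kappa>E w (T' \<eta>))"
    using w by (simp add: M'[symmetric] vector_drury_arveson.reproducing[OF assms(1)]
        vector_drury_arveson.reproducing[OF assms(2)] M T')
qed

text \<open>Let \<open>\<Psi>a w\<close> be the adjoint of \<open>\<Psi> w\<close>. The Gram matrix
  of the \<open>\<kappa>E w \<eta>\<close> minus that of the
  \<open>\<kappa>F w (\<Psi>a w \<eta>)\<close> is the kernel times the defect form of the
  contraction \<open>V\<close>, plus a Gram matrix. Both are positive, the first by the Schur
  product, so the map between these families is contractive and \<open>M\<close> is its
  adjoint.\<close>

lemma transfer_function_multiplier:
  fixes evE :: "'he::chilbert_space \<Rightarrow> complex ^ 'n \<Rightarrow> 'e::chilbert_space"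
    and evF :: "'hf::chilbert_space \<Rightarrow> complex ^ 'n \<Rightarrow> 'f::chilbert_space"
    and W :: "'f \<times> 'k::chilbert_space \<Rightarrow> 'e \<times> ('k ^ 'n)"
  assumes E: "vector_drury_arveson evE \<kappa>E" and F: "vector_drury_arveson evF \<kappa>F"
    and W: "bounded_clinear W 1"
    and \<Psi>: "\<And>z f. z \<in> ball 0 1 \<Longrightarrow>
      \<exists>k. k = (\<Sum>i\<in>UNIV. z $ i *\<^sub>C snd (W (f, k)) $ i) \<and> \<Psi> z f = fst (W (f, k))"
  shows "\<exists>M. bounded_clinear M 1 \<and> (\<forall>f. \<forall>z\<in>ball 0 1. evE (M f) z = \<Psi> z (evF f z))"
proof -
  obtain V where V: "bounded_clinear V 1" and WV: "\<And>x y. cinner (W x) y = cinner x (V y)"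
    using adjoint_exists[OF W] by auto
  have linV: "clinear_map V" and nV: "\<And>x. norm (V x) \<le> norm x"
    using V unfolding bounded_clinear_def mult_1 by blast+
  \<comment> \<open>\<open>Z w\<close> is the adjoint of the row
    \<open>v \<mapsto> (\<Sum>i\<in>UNIV. w $ i *\<^sub>C v $ i)\<close>.\<close>
  define Z :: "complex ^ 'n \<Rightarrow> 'k \<Rightarrow> 'k ^ 'n" where "Z w g = (\<chi> i. cnj (w $ i) *\<^sub>C g)" for w g
  have Z_gram: "cinner (Z w g) (Z z h) = cinner z w * cinner g h" for w z g h
    by (simp add: Z_def cinner_vec_def cinner_complex_def cinner_scaleC_left cinner_scaleC_right
        sum_distrib_left sum_distrib_right mult_ac)
  \<comment> \<open>The feedback equation of the adjoint colligation, solvable because its right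
    side contracts by \<open>norm w\<close>.\<close>
  have "\<exists>g. snd (V (\<eta>, Z w g)) = g" if w: "w \<in> ball 0 1" for w \<eta>
  proof -
    have "\<exists>!g. snd (V (\<eta>, Z w g)) = g"
    proof (rule banach_fix_type[where c = "norm w" and f = "\<lambda>g. snd (V (\<eta>, Z w g))"])
      show "\<forall>g h. dist (snd (V (\<eta>, Z w g))) (snd (V (\<eta>, Z w h))) \<le> norm w * dist g h"
      proof (intro allI)
        fix g h
        have "V (\<eta>, Z w g) - V (\<eta>, Z w h) = V ((\<eta>, Z w g) - (\<eta>, Z w h))"
          by (simp only: clinear_mapD(5)[OF linV])
        also have "(\<eta>, Z w g) - (\<eta>, Z w h) = (0, Z w (g - h))"
          by (simp add: Z_def vec_eq_iff scaleC_diff_right)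
        finally have "snd (V (\<eta>, Z w g)) - snd (V (\<eta>, Z w h)) = snd (V (0, Z w (g - h)))"
          by (metis snd_diff)
        then have "dist (snd (V (\<eta>, Z w g))) (snd (V (\<eta>, Z w h))) \<le> norm (V (0, Z w (g - h)))"
          by (simp only: dist_norm norm_snd_le_norm)
        also have "\<dots> \<le> norm (Z w (g - h))"
          using nV[of "(0, Z w (g - h))"] by (simp only: norm_Pair_0)
        also have "\<dots> = norm w * norm (g - h)"
        proof -
          have "complex_of_real ((norm (Z w (g - h)))\<^sup>2) = complex_of_real ((norm w * norm (g - h))\<^sup>2)"
            unfolding power_mult_distrib of_real_mult cinner_self[symmetric] by (rule Z_gram)
          then have "(norm (Z w (g - h)))\<^sup>2 = (norm w * norm (g - h))\<^sup>2"
            unfolding of_real_eq_iff .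
          then show ?thesis by (rule power2_eq_imp_eq) simp_all
        qed
        finally show "dist (snd (V (\<eta>, Z w g))) (snd (V (\<eta>, Z w h))) \<le> norm w * dist g h"
          by (simp add: dist_norm)
      qed
    qed (use w in auto)
    then show ?thesis by blast
  qed
  then obtain g where g: "\<And>w \<eta>. w \<in> ball 0 1 \<Longrightarrow> snd (V (\<eta>, Z w (g w \<eta>))) = g w \<eta>"
    by metis
  define \<Psi>a where "\<Psi>a w \<eta> = fst (V (\<eta>, Z w (g w \<eta>)))" for w \<eta>
  have V_eq: "V (\<eta>, Z w (g w \<eta>)) = (\<Psi>a w \<eta>, g w \<eta>)" if "w \<in> ball 0 1" for w \<eta>
    using g[OF that] by (simp add: \<Psi>a_def prod_eq_iff)
  have adj: "cinner (\<Psi>a w \<eta>) f = cinner \<eta> (\<Psi> w f)" if w: "w \<in> ball 0 1" for w \<eta> f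
  proof -
    obtain k where k: "k = (\<Sum>i\<in>UNIV. w $ i *\<^sub>C snd (W (f, k)) $ i)" and \<Psi>k: "\<Psi> w f = fst (W (f, k))"
      using \<Psi>[OF w] by blast
    \<comment> \<open>Pairing the solved equations for \<open>V\<close> and \<open>W\<close>, the
      state terms \<open>cinner (g w \<eta>) k\<close> on both sides cancel.\<close>
    have "cinner (\<Psi>a w \<eta>) f + cinner (g w \<eta>) k = cinner (V (\<eta>, Z w (g w \<eta>))) (f, k)"
      by (simp add: V_eq[OF w] cinner_prod_def)
    also have "\<dots> = cinner (\<eta>, Z w (g w \<eta>)) (W (f, k))"
      by (metis WV cinner_commute)
    also have "\<dots> = cinner \<eta> (\<Psi> w f) + cinner (Z w (g w \<eta>)) (snd (W (f, k)))"
      by (simp add: cinner_prod_def \<Psi>k)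
    also have "cinner (Z w (g w \<eta>)) (snd (W (f, k))) = cinner (g w \<eta>) k"
      by (subst k) (simp add: Z_def cinner_vec_def cinner_sum_right cinner_scaleC_left cinner_scaleC_right)
    finally show ?thesis by simp
  qed
  let ?A = "ball 0 1 \<times> UNIV :: ((complex ^ 'n) \<times> 'e) set"
  define u where "u q = \<kappa>E (fst q) (snd q)" for q
  define v where "v q = \<kappa>F (fst q) (\<Psi>a (fst q) (snd q))" for q
  have le: "norm (\<Sum>q\<in>I. c q *\<^sub>C v q) \<le> 1 * norm (\<Sum>q\<in>I. c q *\<^sub>C u q)" if I: "I \<subseteq> ?A" for I c
  proof -
    define x where "x q = (snd q, Z (fst q) (g (fst q) (snd q)))" for q
    define \<gamma> where "\<gamma> q = g (fst q) (snd q)" for q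
    define a where "a q r = cinner (x q) (x r) - cinner (V (x q)) (V (x r))" for q r
    have psd: "0 \<le> Re (\<Sum>q\<in>I. \<Sum>r\<in>I. c q * cnj (c r) * a q r)" for c
    proof -
      have "(\<Sum>q\<in>I. \<Sum>r\<in>I. c q * cnj (c r) * a q r)
          = of_real ((norm (\<Sum>q\<in>I. c q *\<^sub>C x q))\<^sup>2) - of_real ((norm (\<Sum>q\<in>I. c q *\<^sub>C V (x q)))\<^sup>2)"
        unfolding norm_lincomb_square a_def by (simp add: right_diff_distrib sum_subtractf)
      moreover have "(\<Sum>q\<in>I. c q *\<^sub>C V (x q)) = V (\<Sum>q\<in>I. c q *\<^sub>C x q)"
        by (simp add: clinear_mapD[OF linV])
      moreover have "(norm (V (\<Sum>q\<in>I. c q *\<^sub>C x q)))\<^sup>2 \<le> (norm (\<Sum>q\<in>I. c q *\<^sub>C x q))\<^sup>2"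
        by (intro power_mono nV norm_ge_zero)
      ultimately show ?thesis by (simp del: of_real_power)
    qed
    have "0 \<le> Re (\<Sum>q\<in>I. \<Sum>r\<in>I. c q * cnj (c r) * (drury_arveson_kernel (fst r) (fst q) * a q r))"
      using I by (intro drury_arveson_schur psd) auto
    also have "(\<Sum>q\<in>I. \<Sum>r\<in>I. c q * cnj (c r) * (drury_arveson_kernel (fst r) (fst q) * a q r))
        = of_real ((norm (\<Sum>q\<in>I. c q *\<^sub>C u q))\<^sup>2) - of_real ((norm (\<Sum>q\<in>I. c q *\<^sub>C v q))\<^sup>2)
          - of_real ((norm (\<Sum>q\<in>I. c q *\<^sub>C \<gamma> q))\<^sup>2)"
      unfolding norm_lincomb_square sum_subtractf[symmetric] right_diff_distrib[symmetric]
    proof (intro sum.cong refl arg_cong2[of _ _ _ _ "(*)"])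
      fix q r assume "q \<in> I" "r \<in> I"
      then have qr: "fst q \<in> ball 0 1" "fst r \<in> ball 0 1" using I by auto
      let ?k = "drury_arveson_kernel (fst r) (fst q)"
      \<comment> \<open>The state enters once through \<open>Z\<close> and once through
        \<open>V\<close>; together this yields the factor \<open>1 - cinner (fst r) (fst q)\<close>,
        which cancels the kernel.\<close>
      have aqr: "a q r = cinner (snd q) (snd r) - cinner (\<Psi>a (fst q) (snd q)) (\<Psi>a (fst r) (snd r))
          - (1 - cinner (fst r) (fst q)) * cinner (\<gamma> q) (\<gamma> r)"
        unfolding a_def x_def V_eq[OF qr(1)] V_eq[OF qr(2)]
        by (simp add: cinner_prod_def Z_gram \<gamma>_def algebra_simps)
      have "?k * a q r = ?k * cinner (snd q) (snd r)
          - ?k * cinner (\<Psi>a (fst q) (snd q)) (\<Psi>a (fst r) (snd r))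
          - ((1 - cinner (fst r) (fst q)) * ?k) * cinner (\<gamma> q) (\<gamma> r)"
        unfolding aqr by (simp add: algebra_simps)
      then show "?k * a q r = cinner (u q) (u r) - cinner (v q) (v r) - cinner (\<gamma> q) (\<gamma> r)"
        unfolding drury_arveson_kernel_eq(2)[OF qr(2,1)] u_def v_def
          vector_drury_arveson.kernel_gram[OF E qr] vector_drury_arveson.kernel_gram[OF F qr]
        by simp
    qed
    finally have "(norm (\<Sum>q\<in>I. c q *\<^sub>C v q))\<^sup>2 + (norm (\<Sum>q\<in>I. c q *\<^sub>C \<gamma> q))\<^sup>2 \<le> (norm (\<Sum>q\<in>I. c q *\<^sub>C u q))\<^sup>2"
      by (simp del: of_real_power)
    then have "(norm (\<Sum>q\<in>I. c q *\<^sub>C v q))\<^sup>2 \<le> (norm (\<Sum>q\<in>I. c q *\<^sub>C u q))\<^sup>2"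
      by (smt (verit) zero_le_power2)
    then show ?thesis unfolding mult_1 by (rule power2_le_imp_le) simp
  qed
  obtain M where M: "bounded_clinear M 1" and Mu: "\<And>q y. q \<in> ?A \<Longrightarrow> cinner (u q) (M y) = cinner (v q) y"
    using dominated_family_adjoint[of ?A v 1 u] le by fastforce
  have "evE (M f) z = \<Psi> z (evF f z)" if z: "z \<in> ball 0 1" for f z
  proof (rule cinner_eqI_right)
    fix \<eta>
    show "cinner \<eta> (evE (M f) z) = cinner \<eta> (\<Psi> z (evF f z))"
      using Mu[of "(z, \<eta>)" f] z
      by (simp add: u_def v_def vector_drury_arveson.reproducing_left[OF E]
          vector_drury_arveson.reproducing_left[OF F] adj)
  qed
  then show ?thesis using M by blast
qed

text \<open>With blocks \<open>a\<close>, \<open>b\<close>, \<open>c\<close>, \<open>d\<close> of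
  \<open>W\<close>, the feedback equation is \<open>k = Z z (b f + d k)\<close>. Solving it gives
  \<open>\<Psi> z\<close> as \<open>a + c R(z) Z(z) b\<close> with \<open>R z\<close> the inverse of
  \<open>1 - Z(z) d\<close>, and holomorphy follows from that of the resolvent.\<close>

lemma transfer_function_exists:
  fixes W :: "'f::chilbert_space \<times> 'k::chilbert_space \<Rightarrow> 'e::chilbert_space \<times> ('k ^ 'n)"
  assumes W: "bounded_clinear W 1"
  shows "\<exists>\<Psi> :: complex ^ 'n \<Rightarrow> 'f \<Rightarrow>\<^sub>L 'e.
    (\<forall>z\<in>ball 0 1. clinear_map (blinfun_apply (\<Psi> z))) \<and> operator_holomorphic_on \<Psi> (ball 0 1) \<and>
    (\<forall>z\<in>ball 0 1. \<forall>f. \<exists>k. k = (\<Sum>i\<in>UNIV. z $ i *\<^sub>C snd (W (f, k)) $ i) \<and> \<Psi> z f = fst (W (f, k)))"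
proof -
  have linW: "clinear_map W" and nW: "\<And>x. norm (W x) \<le> norm x"
    using W unfolding bounded_clinear_def mult_1 by blast+
  have blW: "bounded_linear W"
    by (rule bounded_clinear_imp_bounded_linear[OF W])
  define a :: "'f \<Rightarrow>\<^sub>L 'e" where "a = Blinfun (\<lambda>f. fst (W (f, 0)))"
  define b :: "'f \<Rightarrow>\<^sub>L ('k ^ 'n)" where "b = Blinfun (\<lambda>f. snd (W (f, 0)))"
  define c :: "'k \<Rightarrow>\<^sub>L 'e" where "c = Blinfun (\<lambda>k. fst (W (0, k)))"
  define d :: "'k \<Rightarrow>\<^sub>L ('k ^ 'n)" where "d = Blinfun (\<lambda>k. snd (W (0, k)))"
  have left: "bounded_linear (\<lambda>f::'f. W (f, 0))" and right: "bounded_linear (\<lambda>k::'k. W (0, k))"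
    by (intro bounded_linear_compose[OF blW] bounded_linear_Pair bounded_linear_ident bounded_linear_zero)+
  have abcd: "a f = fst (W (f, 0))" "b f = snd (W (f, 0))" "c k = fst (W (0, k))" "d k = snd (W (0, k))" for f k
    unfolding a_def b_def c_def d_def
    by (simp_all add: bounded_linear_Blinfun_apply bounded_linear_compose[OF bounded_linear_fst left]
        bounded_linear_compose[OF bounded_linear_snd left] bounded_linear_compose[OF bounded_linear_fst right]
        bounded_linear_compose[OF bounded_linear_snd right])
  have W_split: "W (f, k) = (a f + c k, b f + d k)" for f k
  proof -
    have "W (f, k) = W (f, 0) + W (0, k)"
      by (simp add: clinear_mapD(1)[OF linW, symmetric])
    then show ?thesis by (simp add: abcd prod_eq_iff)
  qed
  have scale: "W (x *\<^sub>C f, 0) = x *\<^sub>C W (f, 0)" "W (0, x *\<^sub>C k) = x *\<^sub>C W (0, k)" for x f k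
    unfolding clinear_mapD(2)[OF linW, symmetric] by (simp_all add: scaleC_prod_def)
  have lin: "a (x *\<^sub>C f) = x *\<^sub>C a f" "b (x *\<^sub>C f) = x *\<^sub>C b f"
      "c (x *\<^sub>C k) = x *\<^sub>C c k" "d (x *\<^sub>C k) = x *\<^sub>C d k" for x f k
    by (simp_all only: abcd scale scaleC_prod_def fst_conv snd_conv)
  have nd: "norm d \<le> 1"
  proof (rule norm_blinfun_bound)
    show "norm (d k) \<le> 1 * norm k" for k
      using order_trans[OF norm_snd_le_norm nW[of "(0, k)"]] by (simp add: abcd norm_Pair_0)
  qed simp
  define Z :: "complex ^ 'n \<Rightarrow> ('k ^ 'n) \<Rightarrow>\<^sub>L 'k" where "Z z = Blinfun (\<lambda>v. \<Sum>i\<in>UNIV. z $ i *\<^sub>C v $ i)" for z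
  have Z_apply: "Z z v = (\<Sum>i\<in>UNIV. z $ i *\<^sub>C v $ i)" for z v
  proof -
    have "bounded_clinear (\<lambda>v :: 'k ^ 'n. \<Sum>i\<in>UNIV. z $ i *\<^sub>C v $ i) (norm z)"
      unfolding bounded_clinear_def clinear_map_def
      using norm_sum_scaleC_vec_le[of z]
      by (auto simp: scaleC_add_right sum.distrib scaleC_vec_def scaleC_scaleC scaleC_sum_right mult.commute)
    then show ?thesis
      unfolding Z_def by (simp add: bounded_linear_Blinfun_apply bounded_clinear_imp_bounded_linear)
  qed
  have Z_smult: "Z (x *s z) v = x *\<^sub>C Z z v" "Z z (x *\<^sub>C v) = x *\<^sub>C Z z v" for x z v
    by (simp_all add: Z_apply scaleC_sum_right scaleC_scaleC scaleC_vec_def mult.commute)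
  have nZ: "norm (Z z) \<le> norm z" for z
    by (rule norm_blinfun_bound) (simp_all add: Z_apply norm_sum_scaleC_vec_le)
  have blZ: "bounded_linear Z"
  proof
    show "Z (x + y) = Z x + Z y" for x y
      by (rule blinfun_eqI) (simp add: Z_apply blinfun.add_left scaleC_add_left sum.distrib)
    show "Z (r *\<^sub>R x) = r *\<^sub>R Z x" for r x
      by (rule blinfun_eqI)
        (simp add: Z_apply blinfun.scaleR_left scaleR_scaleC scaleC_sum_right scaleC_scaleC scaleC_complex_def scaleC_vec_def)
    show "\<exists>K. \<forall>x. norm (Z x) \<le> norm x * K"
      by (rule exI[of _ 1]) (simp add: nZ)
  qed
  define L where "L z = Z z o\<^sub>L d" for z
  have blL: "bounded_linear L"
    unfolding L_def
    by (rule bounded_linear_compose[OF bounded_bilinear.bounded_linear_left[OF bounded_bilinear_blinfun_compose] blZ])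
  have nL: "norm (L z) \<le> norm z" for z
  proof -
    have "norm (L z) \<le> norm (Z z) * norm d"
      unfolding L_def by (rule norm_blinfun_compose)
    also have "\<dots> \<le> norm z * 1"
      by (intro mult_mono nZ nd) simp_all
    finally show ?thesis by simp
  qed
  have "\<exists>R. R - (L z o\<^sub>L R) = id_blinfun \<and> R - (R o\<^sub>L L z) = id_blinfun \<and> norm R \<le> 1 / (1 - norm z)"
    if "z \<in> ball 0 1" for z
  proof -
    have "1 / (1 - norm (L z)) \<le> 1 / (1 - norm z)"
      using that nL[of z] by (intro divide_left_mono mult_pos_pos) auto
    moreover have "norm (L z) < 1"
      using that nL[of z] by simp
    ultimately show ?thesis
      using neumann_inverse[of "L z"] order_trans by blast
  qed
  then obtain R where R1: "\<And>z. z \<in> ball 0 1 \<Longrightarrow> R z - (L z o\<^sub>L R z) = id_blinfun"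
      and R2: "\<And>z. z \<in> ball 0 1 \<Longrightarrow> R z - (R z o\<^sub>L L z) = id_blinfun"
      and nR: "\<And>z. z \<in> ball 0 1 \<Longrightarrow> norm (R z) \<le> 1 / (1 - norm z)"
    by metis
  \<comment> \<open>\<open>R z\<close> is a priori only real-linear; complex homogeneity is
    inherited from \<open>L z\<close> because \<open>R z\<close> is a two-sided inverse of
    \<open>1 - L z\<close>.\<close>
  have R_scale: "R z (x *\<^sub>C k) = x *\<^sub>C R z k" if z: "z \<in> ball 0 1" for z x k
  proof -
    have 1: "R z k - L z (R z k) = k"
      using arg_cong[OF R1[OF z], of "\<lambda>T. T k"] by (simp add: blinfun.diff_left)
    have 2: "R z v - R z (L z v) = v" for v
      using arg_cong[OF R2[OF z], of "\<lambda>T. T v"] by (simp add: blinfun.diff_left)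
    have "x *\<^sub>C R z k - L z (x *\<^sub>C R z k) = x *\<^sub>C k"
      by (subst (3) 1[symmetric]) (simp add: L_def lin Z_smult scaleC_diff_right)
    then show ?thesis
      using 2[of "x *\<^sub>C R z k"] by (metis blinfun.diff_right)
  qed
  define \<Psi> where "\<Psi> z = a + (c o\<^sub>L R z o\<^sub>L Z z o\<^sub>L b)" for z
  have "clinear_map (blinfun_apply (\<Psi> z))" if z: "z \<in> ball 0 1" for z
    unfolding clinear_map_def \<Psi>_def
    by (simp add: blinfun.add_left blinfun.add_right lin Z_smult R_scale[OF z] scaleC_add_right)
  moreover have "operator_holomorphic_on \<Psi> (ball 0 1)"
    unfolding operator_holomorphic_on_def
  proof
    fix z :: "complex ^ 'n" assume z: "z \<in> ball 0 1"
    \<comment> \<open>The bound on the resolvent blows up at the sphere, so a uniform one is taken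
      on a smaller ball that still contains \<open>z\<close>.\<close>
    define r where "r = (1 + norm z) / 2"
    have r: "norm z < r" "r < 1" using z by (simp_all add: r_def)
    have dR: "(R has_derivative (\<lambda>h. R z o\<^sub>L L h o\<^sub>L R z)) (at z)"
    proof (rule resolvent_has_derivative[OF blL, of "ball 0 r" _ _ "1 / (1 - r)"])
      fix w :: "complex ^ 'n" assume w: "w \<in> ball 0 r"
      then have w1: "w \<in> ball 0 1" using r by auto
      show "R w - (L w o\<^sub>L R w) = id_blinfun" "R w - (R w o\<^sub>L L w) = id_blinfun"
        using R1[OF w1] R2[OF w1] .
      have "1 / (1 - norm w) \<le> 1 / (1 - r)"
        using w r by (intro divide_left_mono mult_pos_pos) auto
      then show "norm (R w) \<le> 1 / (1 - r)"
        using nR[OF w1] by simp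
    qed (use r in auto)
    let ?D = "\<lambda>h. c o\<^sub>L ((R z o\<^sub>L Z h) + ((R z o\<^sub>L L h o\<^sub>L R z) o\<^sub>L Z z)) o\<^sub>L b"
    have dZ: "(Z has_derivative Z) (at z)"
      by (rule bounded_linear_imp_has_derivative[OF blZ])
    have "((\<lambda>z. R z o\<^sub>L Z z) has_derivative (\<lambda>h. (R z o\<^sub>L Z h) + ((R z o\<^sub>L L h o\<^sub>L R z) o\<^sub>L Z z))) (at z)"
      by (rule bounded_bilinear.FDERIV[OF bounded_bilinear_blinfun_compose dR dZ])
    from bounded_linear.has_derivative[OF bounded_bilinear.bounded_linear_left[OF bounded_bilinear_blinfun_compose]
        bounded_linear.has_derivative[OF bounded_bilinear.bounded_linear_right[OF bounded_bilinear_blinfun_compose] this]]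
    have "((\<lambda>z. a + (c o\<^sub>L (R z o\<^sub>L Z z) o\<^sub>L b)) has_derivative (\<lambda>h. 0 + ?D h)) (at z)"
      by (rule has_derivative_add[OF has_derivative_const])
    moreover have "\<Psi> = (\<lambda>z. a + (c o\<^sub>L (R z o\<^sub>L Z z) o\<^sub>L b))"
      by (intro ext blinfun_eqI) (simp add: \<Psi>_def blinfun.add_left)
    ultimately have "(\<Psi> has_derivative ?D) (at z)"
      by (simp only: add_0_left)
    moreover have "?D (x *s v) y = x *\<^sub>C ?D v y" for x v y
      by (simp add: blinfun.add_left blinfun.add_right L_def Z_smult lin R_scale[OF z] scaleC_add_right)
    ultimately show "\<exists>D. (\<Psi> has_derivative D) (at z) \<and>
        (\<forall>c v x. blinfun_apply (D (c *s v)) x = c *\<^sub>C blinfun_apply (D v) x)"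
      by blast
  qed
  moreover have "\<exists>k. k = (\<Sum>i\<in>UNIV. z $ i *\<^sub>C snd (W (f, k)) $ i) \<and> \<Psi> z f = fst (W (f, k))"
    if z: "z \<in> ball 0 1" for z f
  proof -
    define k where "k = R z (Z z (b f))"
    have "k - L z k = Z z (b f)"
      using arg_cong[OF R1[OF z], of "\<lambda>T. T (Z z (b f))"] by (simp add: blinfun.diff_left k_def)
    then have "k = Z z (snd (W (f, k)))"
      by (simp add: W_split L_def blinfun.add_right algebra_simps)
    moreover have "\<Psi> z f = fst (W (f, k))"
      by (simp add: W_split \<Psi>_def blinfun.add_left k_def)
    ultimately show ?thesis
      unfolding Z_apply by blast
  qed
  ultimately show ?thesis by blast
qed

subsection \<open>Regular inverses and complements\<close>

text \<open>The operator supplied by \<open>multiplier\<close> is only real-linear; complex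
  linearity is checked on values, which determine the function.\<close>

lemma clinear_mult_op:
  assumes E: "function_space (ball 0 1) evE" and F: "function_space (ball 0 1) evF"
    and \<Theta>: "\<And>z. z \<in> ball 0 1 \<Longrightarrow> clinear_map (blinfun_apply (\<Theta> z))"
    and M: "is_mult_op evE evF \<Theta> M"
  shows "clinear_map M"
proof -
  have linE: "clinear_map (\<lambda>f. evE f z)" and linF: "clinear_map (\<lambda>f. evF f z)" if "z \<in> ball 0 1" for z
    using E F that by (auto simp: function_space_def)
  have ext: "f = g" if eq: "\<And>z. z \<in> ball 0 1 \<Longrightarrow> evF f z = evF g z" for f g
  proof -
    have "\<forall>z\<in>ball 0 1. evF (f - g) z = 0"
      using eq by (simp add: clinear_mapD(5)[OF linF])
    then show ?thesis
      using F unfolding function_space_def by (metis eq_iff_diff_eq_0)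
  qed
  show ?thesis
    unfolding clinear_map_def
    by (intro conjI allI; rule ext)
      (use M in \<open>simp_all add: is_mult_op_def clinear_mapD(1,2)[OF linE] clinear_mapD(1,2)[OF linF]
        clinear_mapD(1,2)[OF \<Theta>]\<close>)
qed

lemma regular_inverse_imp_complemented:
  fixes evE :: "'he::chilbert_space \<Rightarrow> complex ^ 'n \<Rightarrow> 'e::chilbert_space"
    and evF :: "'hf::chilbert_space \<Rightarrow> complex ^ 'n \<Rightarrow> 'f::chilbert_space"
  assumes E: "vector_drury_arveson evE \<kappa>E" and F: "vector_drury_arveson evF \<kappa>F"
    and \<Theta>: "multiplier evE evF \<Theta>" and inv: "has_regular_inverse evE evF \<Theta>"
  shows "\<exists>S. submodule evF S \<and> algebraic_direct_sum (range (mult_op evE evF \<Theta>)) S"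
proof -
  interpret E: vector_drury_arveson evE \<kappa>E by fact
  interpret F: vector_drury_arveson evF \<kappa>F by fact
  obtain \<Psi> where \<Psi>: "multiplier evF evE \<Psi>"
    and reg: "\<And>z. z \<in> ball 0 1 \<Longrightarrow> \<Theta> z o\<^sub>L \<Psi> z o\<^sub>L \<Theta> z = \<Theta> z"
    using inv by (auto simp: has_regular_inverse_def)
  obtain M where blM: "bounded_linear M" and M: "is_mult_op evE evF \<Theta> M"
    and lin\<Theta>: "\<And>z. z \<in> ball 0 1 \<Longrightarrow> clinear_map (blinfun_apply (\<Theta> z))"
    using \<Theta> by (auto simp: multiplier_def)
  obtain N where blN: "bounded_linear N" and N: "is_mult_op evF evE \<Psi> N"
    and lin\<Psi>: "\<And>z. z \<in> ball 0 1 \<Longrightarrow> clinear_map (blinfun_apply (\<Psi> z))"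
    using \<Psi> by (auto simp: multiplier_def)
  have M_ev: "evF (M f) z = \<Theta> z (evE f z)" if "z \<in> ball 0 1" for f z
    using M that by (simp add: is_mult_op_def)
  have N_ev: "evE (N f) z = \<Psi> z (evF f z)" if "z \<in> ball 0 1" for f z
    using N that by (simp add: is_mult_op_def)
  have op: "mult_op evE evF \<Theta> = M"
    by (rule mult_op_eqI[OF F.function_space M])
  have MNM: "M (N (M f)) = M f" for f
  proof (rule F.function_eqI)
    fix z :: "complex ^ 'n" assume z: "z \<in> ball 0 1"
    have "\<Theta> z (\<Psi> z (\<Theta> z x)) = \<Theta> z x" for x
      using arg_cong[OF reg[OF z], of "\<lambda>T. T x"] by simp
    then show "evF (M (N (M f))) z = evF (M f) z"
      using z by (simp add: M_ev N_ev)
  qed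
  have linM: "clinear_map M"
    by (rule clinear_mult_op[OF E.function_space F.function_space lin\<Theta> M])
  have linN: "clinear_map N"
    by (rule clinear_mult_op[OF F.function_space E.function_space lin\<Psi> N])
  \<comment> \<open>By \<open>MNM\<close> the composite of \<open>M\<close> after \<open>N\<close>
    is idempotent with the range of \<open>M\<close>; \<open>S\<close> is its kernel.\<close>
  define S where "S = {f. M (N f) = 0}"
  have "submodule evF S"
    unfolding submodule_def
  proof (intro conjI allI ballI)
    have "bounded_linear (\<lambda>f. M (N f))"
      by (rule bounded_linear_compose[OF blM blN])
    then show "closed S"
      unfolding S_def by (intro closed_Collect_eq linear_continuous_on continuous_on_const)
    show "csubspace S"
      by (simp add: csubspace_def S_def clinear_mapD[OF linM] clinear_mapD[OF linN])
    fix i f assume f: "f \<in> S"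
    obtain g where g: "\<And>z. z \<in> ball 0 1 \<Longrightarrow> evF g z = z $ i *\<^sub>C evF f z"
      using F.coordinate_multiplication by blast
    have "M (N g) = 0"
    proof (rule F.function_eqI)
      fix z :: "complex ^ 'n" assume z: "z \<in> ball 0 1"
      \<comment> \<open>Both operators act pointwise and complex-linearly, so they commute with the
        coordinates and the kernel is invariant.\<close>
      have "evF (M (N g)) z = z $ i *\<^sub>C evF (M (N f)) z"
        using z by (simp add: M_ev N_ev g clinear_mapD(2)[OF lin\<Psi>] clinear_mapD(2)[OF lin\<Theta>])
      then show "evF (M (N g)) z = evF 0 z"
        using f z by (simp add: S_def F.ev_simps)
    qed
    then show "\<exists>g\<in>S. \<forall>z\<in>ball 0 1. evF g z = z $ i *\<^sub>C evF f z"
      using g by (auto simp: S_def)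
  qed
  moreover have "algebraic_direct_sum (range M) S"
    unfolding algebraic_direct_sum_def
  proof (intro conjI allI equalityI subsetI)
    show "x \<in> {0}" if "x \<in> range M \<inter> S" for x
      using that MNM by (auto simp: S_def)
    show "x \<in> range M \<inter> S" if "x \<in> {0}" for x
      using that by (auto simp: S_def clinear_mapD[OF linM] clinear_mapD[OF linN]
          intro: range_eqI[of _ _ 0])
    show "\<exists>a\<in>range M. \<exists>b\<in>S. h = a + b" for h
    proof (intro bexI)
      show "h = M (N h) + (h - M (N h))" by simp
      show "h - M (N h) \<in> S"
        by (simp add: S_def clinear_mapD[OF linM] clinear_mapD[OF linN] MNM)
    qed simp
  qed
  ultimately show ?thesis
    unfolding op by blast
qed

text \<open>The Leech-type theorem for the Drury-Arveson kernel: \<open>norm (P\<^sup>* y) \<le> C norm (M\<^sup>* y)\<close> makes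
  \<open>c\<^sup>2 \<Theta>(z) \<Theta>(w)\<^sup>* - Q(z) Q(w)\<^sup>* = (1 - \<langle>z, w\<rangle>) \<Gamma>(z) \<Gamma>(w)\<^sup>*\<close> for some \<open>\<Gamma>\<close>, which says that
  \<open>u\<close> and \<open>v\<close> below have equal Gram matrices; the resulting contraction is the colligation
  whose transfer function is \<open>\<Psi>\<close>.\<close>

lemma module_map_factorization:
  fixes evE :: "'he::chilbert_space \<Rightarrow> complex ^ 'n \<Rightarrow> 'e::chilbert_space"
    and evF :: "'hf::chilbert_space \<Rightarrow> complex ^ 'n \<Rightarrow> 'f::chilbert_space"
  assumes E: "vector_drury_arveson evE \<kappa>E" and F: "vector_drury_arveson evF \<kappa>F"
    and lin\<Theta>: "\<And>z. z \<in> ball 0 1 \<Longrightarrow> clinear_map (blinfun_apply (\<Theta> z))"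
    and M: "bounded_clinear M B" "0 \<le> B"
    and M_ev: "\<And>f z. z \<in> ball 0 1 \<Longrightarrow> evF (M f) z = blinfun_apply (\<Theta> z) (evE f z)"
    and P: "bounded_clinear P D" "0 \<le> D"
    and module: "\<And>i f g z. (\<And>z. z \<in> ball 0 1 \<Longrightarrow> evF g z = z $ i *\<^sub>C evF f z) \<Longrightarrow> z \<in> ball 0 1 \<Longrightarrow>
      evF (P g) z = z $ i *\<^sub>C evF (P f) z"
    and range: "\<And>y. \<exists>x. P y = M x \<and> norm x \<le> C * norm y" and "0 \<le> C"
  shows "\<exists>\<Psi>. multiplier evF evE \<Psi> \<and>
    (\<forall>y. \<forall>z\<in>ball 0 1. blinfun_apply (\<Theta> z) (blinfun_apply (\<Psi> z) (evF y z)) = evF (P y) z)"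
proof -
  interpret E: vector_drury_arveson evE \<kappa>E by fact
  interpret F: vector_drury_arveson evF \<kappa>F by fact
  obtain M' where M': "bounded_clinear M' B" "\<And>x y. cinner (M x) y = cinner x (M' y)"
    using adjoint_exists[OF M] by blast
  obtain P' where P': "bounded_clinear P' D" "\<And>x y. cinner (P x) y = cinner x (P' y)"
    using adjoint_exists[OF P] by blast
  have dominated: "norm (P' y) \<le> C * norm (M' y)" for y
  proof -
    \<comment> \<open>The bounded lift of \<open>P\<close> through \<open>M\<close> dominates
      adjoints: writing \<open>P (P' y)\<close> as \<open>M x\<close> turns
      \<open>(norm (P' y))\<^sup>2\<close> into \<open>cinner x (M' y)\<close>.\<close>
    obtain x where x: "P (P' y) = M x" "norm x \<le> C * norm (P' y)"
      using range by blast
    have "(norm (P' y))\<^sup>2 = norm (cinner (P' y) (P' y))"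
      by (simp add: cinner_self norm_power)
    also have "\<dots> = norm (cinner x (M' y))"
      by (simp add: P'(2)[symmetric] x(1) M'(2))
    also have "\<dots> \<le> (C * norm (P' y)) * norm (M' y)"
      by (rule order_trans[OF norm_cinner_le]) (intro mult_right_mono x norm_ge_zero)
    finally have le: "norm (P' y) * norm (P' y) \<le> (C * norm (M' y)) * norm (P' y)"
      by (simp add: power2_eq_square mult_ac)
    show ?thesis
    proof (cases "P' y = 0")
      case True
      then show ?thesis using \<open>0 \<le> C\<close> by simp
    next
      case False
      then show ?thesis using le by (simp add: mult_le_cancel_right)
    qed
  qed
  obtain c :: real and \<Gamma> :: "'hf \<Rightarrow> 'he" where c: "0 < c" and
    \<Gamma>: "\<And>x y. cinner (\<Gamma> x) (\<Gamma> y) = (of_real c)\<^sup>2 * cinner (M' x) (M' y) - cinner (P' x) (P' y)"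
    using domination_defect[of M' P' C] dominated \<open>0 \<le> C\<close> M'(1) P'(1)
    unfolding bounded_clinear_def by blast
  have blP: "bounded_linear P"
    by (rule bounded_clinear_imp_bounded_linear[OF P(1)])
  \<comment> \<open>\<open>Q\<close> is the symbol of \<open>P\<close>, read off from constants;
    \<open>P_ev\<close> confirms that \<open>P\<close> multiplies by it.\<close>
  define Q where "Q w \<eta> = evF (P (\<kappa>F 0 \<eta>)) w" for w \<eta>
  have P_ev: "evF (P y) w = Q w (evF y w)" if "w \<in> ball 0 1" for y w
    unfolding Q_def by (rule F.module_map_ev[OF P(1) module that])
  have lin\<kappa>: "clinear_map (\<kappa>F 0)"
    by (rule F.clinear_kernel) simp
  have "\<exists>T'. \<forall>x y. cinner (Q w x) y = cinner x (T' y)" if w: "w \<in> ball 0 1" for w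
  proof -
    have "bounded_clinear (\<kappa>F 0) 1"
      using lin\<kappa> by (simp add: bounded_clinear_def F.norm_kernel_0)
    then have "bounded_linear (Q w)"
      unfolding Q_def
      by (intro bounded_linear_compose[OF F.bounded_ev[OF w]] bounded_linear_compose[OF blP]
          bounded_clinear_imp_bounded_linear)
    moreover have "clinear_map (Q w)"
      unfolding Q_def using P(1)
      by (intro clinear_map_compose[OF F.clinear_ev[OF w]] clinear_map_compose[OF _ lin\<kappa>])
        (simp add: bounded_clinear_def)
    ultimately obtain K where "0 \<le> K" "bounded_clinear (Q w) K"
      by (rule bounded_linear_imp_bounded_clinear)
    then show ?thesis using adjoint_exists by blast
  qed
  then obtain Q' where Q': "\<And>w x y. w \<in> ball 0 1 \<Longrightarrow> cinner (Q w x) y = cinner x (Q' w y)"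
    by metis
  have "\<exists>T'. \<forall>x y. cinner (\<Theta> w x) y = cinner x (T' y)" if w: "w \<in> ball 0 1" for w
  proof -
    obtain K where "0 \<le> K" "bounded_clinear (\<Theta> w) K"
      using bounded_linear_imp_bounded_clinear[OF blinfun.bounded_linear_right lin\<Theta>[OF w]] .
    then show ?thesis using adjoint_exists by blast
  qed
  then obtain \<Theta>' where \<Theta>': "\<And>w x y. w \<in> ball 0 1 \<Longrightarrow> cinner (\<Theta> w x) y = cinner x (\<Theta>' w y)"
    by metis
  have M'\<kappa>: "M' (\<kappa>F w \<eta>) = \<kappa>E w (\<Theta>' w \<eta>)" if w: "w \<in> ball 0 1" for w \<eta>
    by (rule adjoint_kernel[OF E F M_ev[OF w] M'(2) \<Theta>'[OF w] w])
  have P'\<kappa>: "P' (\<kappa>F w \<eta>) = \<kappa>F w (Q' w \<eta>)" if w: "w \<in> ball 0 1" for w \<eta>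
    by (rule adjoint_kernel[OF F F P_ev[OF w] P'(2) Q'[OF w] w])
  let ?A = "ball 0 1 \<times> UNIV :: ((complex ^ 'n) \<times> 'f) set"
  define \<gamma> where "\<gamma> q = \<Gamma> (\<kappa>F (fst q) (snd q))" for q
  define u :: "(complex ^ 'n) \<times> 'f \<Rightarrow> 'e \<times> ('he ^ 'n)"
    where "u q = (of_real c *\<^sub>C \<Theta>' (fst q) (snd q), \<chi> i. cnj (fst q $ i) *\<^sub>C \<gamma> q)" for q
  define v where "v q = (Q' (fst q) (snd q), \<gamma> q)" for q
  have gram: "cinner (u q) (u r) = cinner (v q) (v r)" if "q \<in> ?A" "r \<in> ?A" for q r
  proof -
    have qr: "fst q \<in> ball 0 1" "fst r \<in> ball 0 1" using that by auto
    let ?k = "drury_arveson_kernel (fst r) (fst q)"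
    let ?\<theta> = "cinner (\<Theta>' (fst q) (snd q)) (\<Theta>' (fst r) (snd r))"
    let ?\<pi> = "cinner (Q' (fst q) (snd q)) (Q' (fst r) (snd r))"
    have "cinner (\<gamma> q) (\<gamma> r) = ?k * ((of_real c)\<^sup>2 * ?\<theta> - ?\<pi>)"
      unfolding \<gamma>_def \<Gamma> M'\<kappa>[OF qr(1)] M'\<kappa>[OF qr(2)] P'\<kappa>[OF qr(1)] P'\<kappa>[OF qr(2)]
        E.kernel_gram[OF qr] F.kernel_gram[OF qr]
      by (simp add: algebra_simps)
    \<comment> \<open>The reciprocal of the kernel is \<open>1 - cinner (fst r) (fst q)\<close>;
      multiplying by it strips the kernel and leaves an identity between pointwise Gram
      matrices.\<close>
    then have "(1 - cinner (fst r) (fst q)) * cinner (\<gamma> q) (\<gamma> r)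
        = ((1 - cinner (fst r) (fst q)) * ?k) * ((of_real c)\<^sup>2 * ?\<theta> - ?\<pi>)"
      by simp
    then have eq: "(1 - cinner (fst r) (fst q)) * cinner (\<gamma> q) (\<gamma> r) = (of_real c)\<^sup>2 * ?\<theta> - ?\<pi>"
      unfolding drury_arveson_kernel_eq(2)[OF qr(2,1)] by simp
    have "cinner (u q) (u r) = (of_real c)\<^sup>2 * ?\<theta> + cinner (fst r) (fst q) * cinner (\<gamma> q) (\<gamma> r)"
      by (simp add: u_def cinner_prod_def cinner_vec_def cinner_complex_def cinner_scaleC_left
          cinner_scaleC_right power2_eq_square sum_distrib_left sum_distrib_right mult_ac)
    also have "\<dots> = ?\<pi> + cinner (\<gamma> q) (\<gamma> r)"
      using eq by (simp add: algebra_simps)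
    finally show ?thesis
      by (simp add: v_def cinner_prod_def)
  qed
  have "norm (\<Sum>q\<in>I. a q *\<^sub>C v q) \<le> 1 * norm (\<Sum>q\<in>I. a q *\<^sub>C u q)" if I: "I \<subseteq> ?A" for I a
    unfolding mult_1
    by (rule lincomb_norm_le_of_gram[where g = "\<lambda>_. 0::complex"]) (simp add: gram[OF subsetD[OF I] subsetD[OF I]])
  then obtain W where W: "bounded_clinear W 1" and Wu: "\<And>q y. q \<in> ?A \<Longrightarrow> cinner (u q) (W y) = cinner (v q) y"
    using dominated_family_adjoint[of ?A v 1 u] by fastforce
  obtain \<Psi> :: "complex ^ 'n \<Rightarrow> 'f \<Rightarrow>\<^sub>L 'e"
    where lin\<Psi>: "\<And>z. z \<in> ball 0 1 \<Longrightarrow> clinear_map (blinfun_apply (\<Psi> z))"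
      and hol\<Psi>: "operator_holomorphic_on \<Psi> (ball 0 1)"
      and \<Psi>: "\<And>z f. z \<in> ball 0 1 \<Longrightarrow>
        \<exists>k. k = (\<Sum>i\<in>UNIV. z $ i *\<^sub>C snd (W (f, k)) $ i) \<and> \<Psi> z f = fst (W (f, k))"
    using transfer_function_exists[OF W] by blast
  obtain N where N: "bounded_clinear N 1" and N_ev: "\<And>f z. z \<in> ball 0 1 \<Longrightarrow> evE (N f) z = \<Psi> z (evF f z)"
    using transfer_function_multiplier[OF E F W, of "\<lambda>z. blinfun_apply (\<Psi> z)"] \<Psi> by blast
  have factor: "of_real c *\<^sub>C \<Theta> z (\<Psi> z f) = Q z f" if z: "z \<in> ball 0 1" for z f
  proof (rule cinner_eqI_right)
    fix \<eta>
    obtain k where k: "k = (\<Sum>i\<in>UNIV. z $ i *\<^sub>C snd (W (f, k)) $ i)" and \<Psi>k: "\<Psi> z f = fst (W (f, k))"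
      using \<Psi>[OF z] by blast
    have adj: "cinner (\<Theta>' z \<eta>) x = cinner \<eta> (\<Theta> z x)" "cinner (Q' z \<eta>) y = cinner \<eta> (Q z y)" for x y
      by (metis cinner_commute \<Theta>'[OF z], metis cinner_commute Q'[OF z])
    \<comment> \<open>\<open>W\<close> is tested against \<open>u (z, \<eta>)\<close>. The feedback
      equation makes the state terms on both sides equal, and what is left is the factorization
      paired with \<open>\<eta>\<close>.\<close>
    have "cinner \<eta> (of_real c *\<^sub>C \<Theta> z (\<Psi> z f)) + cinner (\<gamma> (z, \<eta>)) (\<Sum>i\<in>UNIV. z $ i *\<^sub>C snd (W (f, k)) $ i)
        = cinner (u (z, \<eta>)) (W (f, k))"
      by (simp add: u_def cinner_prod_def cinner_vec_def cinner_scaleC_left cinner_scaleC_right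
          cinner_sum_right adj \<Psi>k)
    also have "\<dots> = cinner \<eta> (Q z f) + cinner (\<gamma> (z, \<eta>)) k"
      using z by (subst Wu) (simp_all add: v_def cinner_prod_def adj)
    finally show "cinner \<eta> (of_real c *\<^sub>C \<Theta> z (\<Psi> z f)) = cinner \<eta> (Q z f)"
      by (simp only: k[symmetric] add_right_cancel)
  qed
  \<comment> \<open>Rescaling absorbs the constant \<open>c\<close> of the defect.\<close>
  define \<Phi> where "\<Phi> z = c *\<^sub>R \<Psi> z" for z
  have \<Phi>_apply: "\<Phi> z f = of_real c *\<^sub>C \<Psi> z f" for z f
    by (simp add: \<Phi>_def blinfun.scaleR_left scaleR_scaleC)
  have "multiplier evF evE \<Phi>"
    unfolding multiplier_def
  proof (intro conjI ballI exI)
    show "clinear_map (blinfun_apply (\<Phi> z))" if "z \<in> ball 0 1" for z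
      using lin\<Psi>[OF that]
      by (simp add: clinear_map_def \<Phi>_apply scaleC_add_right scaleC_scaleC mult.commute)
    show "operator_holomorphic_on \<Phi> (ball 0 1)"
      unfolding operator_holomorphic_on_def
    proof
      fix z :: "complex ^ 'n" assume "z \<in> ball 0 1"
      then obtain D where D: "(\<Psi> has_derivative D) (at z)"
          "\<And>a v x. blinfun_apply (D (a *s v)) x = a *\<^sub>C blinfun_apply (D v) x"
        using hol\<Psi> unfolding operator_holomorphic_on_def by blast
      have "(\<Phi> has_derivative (\<lambda>h. c *\<^sub>R D h)) (at z)"
        unfolding \<Phi>_def by (rule has_derivative_scaleR_right[OF D(1)])
      then show "\<exists>D. (\<Phi> has_derivative D) (at z) \<and>
          (\<forall>a v x. blinfun_apply (D (a *s v)) x = a *\<^sub>C blinfun_apply (D v) x)"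
        by (intro exI[of _ "\<lambda>h. c *\<^sub>R D h"])
          (simp add: blinfun.scaleR_left D(2) scaleR_scaleC scaleC_scaleC mult.commute)
    qed
    show "bounded_linear (\<lambda>f. c *\<^sub>R N f)"
      by (intro bounded_linear_compose[OF bounded_linear_scaleR_right] bounded_clinear_imp_bounded_linear[OF N])
    show "is_mult_op evF evE \<Phi> (\<lambda>f. c *\<^sub>R N f)"
      by (simp add: is_mult_op_def scaleR_scaleC E.ev_simps N_ev \<Phi>_apply)
  qed
  moreover have "\<Theta> z (\<Phi> z (evF y z)) = evF (P y) z" if z: "z \<in> ball 0 1" for y z
    by (simp add: \<Phi>_apply clinear_mapD(2)[OF lin\<Theta>[OF z]] factor[OF z] P_ev[OF z])
  ultimately show ?thesis by blast
qed

lemma complemented_imp_regular_inverse: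
  fixes evE :: "'he::chilbert_space \<Rightarrow> complex ^ 'n \<Rightarrow> 'e::chilbert_space"
    and evF :: "'hf::chilbert_space \<Rightarrow> complex ^ 'n \<Rightarrow> 'f::chilbert_space"
  assumes E: "vector_drury_arveson evE \<kappa>E" and F: "vector_drury_arveson evF \<kappa>F"
    and \<Theta>: "multiplier evE evF \<Theta>"
    and S: "submodule evF S" and sum: "algebraic_direct_sum (range (mult_op evE evF \<Theta>)) S"
  shows "has_regular_inverse evE evF \<Theta>"
proof -
  interpret E: vector_drury_arveson evE \<kappa>E by fact
  interpret F: vector_drury_arveson evF \<kappa>F by fact
  obtain M where blM: "bounded_linear M" and M: "is_mult_op evE evF \<Theta> M"
    and lin\<Theta>: "\<And>z. z \<in> ball 0 1 \<Longrightarrow> clinear_map (blinfun_apply (\<Theta> z))"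
    using \<Theta> by (auto simp: multiplier_def)
  have M_ev: "evF (M f) z = \<Theta> z (evE f z)" if "z \<in> ball 0 1" for f z
    using M that by (simp add: is_mult_op_def)
  have op: "mult_op evE evF \<Theta> = M"
    by (rule mult_op_eqI[OF F.function_space M])
  have linM: "clinear_map M"
    by (rule clinear_mult_op[OF E.function_space F.function_space lin\<Theta> M])
  obtain B where B: "0 \<le> B" "bounded_clinear M B"
    using bounded_linear_imp_bounded_clinear[OF blM linM] .
  have int: "range M \<inter> S = {0}" and dec: "\<And>h. \<exists>a\<in>range M. \<exists>b\<in>S. h = a + b"
    using sum unfolding op algebraic_direct_sum_def by blast+
  have "closed S" and S0: "0 \<in> S" and Sadd: "\<And>x y. x \<in> S \<Longrightarrow> y \<in> S \<Longrightarrow> x + y \<in> S"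
    and Ssc: "\<And>c x. x \<in> S \<Longrightarrow> c *\<^sub>C x \<in> S"
    and Smod: "\<And>i f. f \<in> S \<Longrightarrow> \<exists>g\<in>S. \<forall>z\<in>ball 0 1. evF g z = z $ i *\<^sub>C evF f z"
    using S by (auto simp: submodule_def csubspace_def)
  have "subspace S"
    using S0 Sadd Ssc by (simp add: subspace_def scaleR_scaleC)
  then have Sdiff: "\<And>x y. x \<in> S \<Longrightarrow> y \<in> S \<Longrightarrow> x - y \<in> S"
    by (rule subspace_diff)
  obtain C where C: "0 \<le> C" and "\<And>y. \<exists>x. y - M x \<in> S \<and> norm x \<le> C * norm y"
    using open_mapping_complement[OF blM \<open>subspace S\<close> \<open>closed S\<close>] dec by (metis rangeE)
  then obtain X where XS: "\<And>y. y - M (X y) \<in> S" and nX: "\<And>y. norm (X y) \<le> C * norm y"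
    by metis
  define P where "P y = M (X y)" for y
  \<comment> \<open>Two admissible lifts have images differing by an element of
    \<open>range M \<inter> S\<close>. So \<open>P\<close> does not depend on the choice of
    \<open>X\<close>, which need not be linear; linearity of \<open>P\<close> follows from
    this.\<close>
  have unique: "P y = M x" if "y - M x \<in> S" for x y
  proof -
    have "(y - M x) - (y - M (X y)) \<in> S"
      by (rule Sdiff[OF that XS])
    moreover have "(y - M x) - (y - M (X y)) = M (X y - x)"
      by (simp add: clinear_mapD[OF linM])
    ultimately have "M (X y - x) = 0"
      using int by auto
    then show ?thesis by (simp add: P_def clinear_mapD[OF linM])
  qed
  have P_bounded: "bounded_clinear P (B * C)"
    unfolding bounded_clinear_def clinear_map_def
  proof (intro conjI allI)
    show "P (x + y) = P x + P y" for x y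
    proof -
      have "P (x + y) = M (X x + X y)"
        by (rule unique) (use Sadd[OF XS[of x] XS[of y]] in \<open>simp add: clinear_mapD[OF linM] algebra_simps\<close>)
      then show ?thesis by (simp add: P_def clinear_mapD[OF linM])
    qed
    show "P (a *\<^sub>C x) = a *\<^sub>C P x" for a x
    proof -
      have "P (a *\<^sub>C x) = M (a *\<^sub>C X x)"
        by (rule unique) (use Ssc[OF XS[of x], of a] in \<open>simp add: clinear_mapD[OF linM] scaleC_diff_right\<close>)
      then show ?thesis by (simp add: P_def clinear_mapD[OF linM])
    qed
    show "norm (P x) \<le> B * C * norm x" for x
    proof -
      have "norm (P x) \<le> B * norm (X x)"
        using B(2) unfolding P_def bounded_clinear_def by blast
      also have "\<dots> \<le> B * (C * norm x)"
        by (intro mult_left_mono nX B)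
      finally show ?thesis by (simp add: mult.assoc)
    qed
  qed
  have module: "evF (P g) z = z $ i *\<^sub>C evF (P f) z"
    if g: "\<And>z. z \<in> ball 0 1 \<Longrightarrow> evF g z = z $ i *\<^sub>C evF f z" and z: "z \<in> ball 0 1" for i f g z
  proof -
    obtain x where x: "\<And>z. z \<in> ball 0 1 \<Longrightarrow> evE x z = z $ i *\<^sub>C evE (X f) z"
      using E.coordinate_multiplication by blast
    obtain s where s: "s \<in> S" "\<And>z. z \<in> ball 0 1 \<Longrightarrow> evF s z = z $ i *\<^sub>C evF (f - M (X f)) z"
      using Smod[OF XS[of f]] by blast
    have Mx: "evF (M x) z = z $ i *\<^sub>C evF (M (X f)) z" if "z \<in> ball 0 1" for z
      using that by (simp add: M_ev x clinear_mapD(2)[OF lin\<Theta>])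
    \<comment> \<open>Multiplying \<open>f = M (X f) + (f - M (X f))\<close> by a coordinate keeps
      the parts in \<open>range M\<close> and in \<open>S\<close>, so \<open>x\<close> is an
      admissible lift of \<open>g\<close>.\<close>
    have "g - M x = s"
      by (rule F.function_eqI) (simp add: F.ev_simps g s(2) Mx scaleC_diff_right)
    then have "P g = M x"
      using s(1) by (intro unique) simp
    then show ?thesis by (simp add: Mx[OF z] P_def)
  qed
  have "0 \<le> B * C" using B C by simp
  obtain \<Psi> where \<Psi>: "multiplier evF evE \<Psi>"
    and fac: "\<And>y z. z \<in> ball 0 1 \<Longrightarrow> \<Theta> z (\<Psi> z (evF y z)) = evF (P y) z"
    using module_map_factorization[OF E F lin\<Theta> B(2,1) M_ev P_bounded \<open>0 \<le> B * C\<close> module _ C] nX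
    unfolding P_def by blast
  have "\<Theta> z o\<^sub>L \<Psi> z o\<^sub>L \<Theta> z = \<Theta> z" if z: "z \<in> ball 0 1" for z
  proof (rule blinfun_eqI)
    fix \<eta>
    \<comment> \<open>\<open>P\<close> fixes \<open>range M\<close>; the factorization is applied to
      the image of the constant \<open>\<eta>\<close>, whose value at \<open>z\<close> is
      \<open>\<Theta> z \<eta>\<close>.\<close>
    have ev: "evF (M (\<kappa>E 0 \<eta>)) z = \<Theta> z \<eta>"
      using z by (simp add: M_ev E.ev_kernel)
    have "P (M (\<kappa>E 0 \<eta>)) = M (\<kappa>E 0 \<eta>)"
      by (rule unique) (simp add: S0)
    then show "(\<Theta> z o\<^sub>L \<Psi> z o\<^sub>L \<Theta> z) \<eta> = \<Theta> z \<eta>"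
      using fac[OF z, of "M (\<kappa>E 0 \<eta>)"] by (simp add: ev)
  qed
  then show ?thesis
    using \<Psi> by (auto simp: has_regular_inverse_def)
qed

theorem theorem5p4:
  fixes ev :: "'h::chilbert_space \<Rightarrow> complex ^ 'n \<Rightarrow> complex"
    and evE :: "'he::chilbert_space \<Rightarrow> complex ^ 'n \<Rightarrow> 'e::{chilbert_space, second_countable_topology}"
    and evF :: "'hf::chilbert_space \<Rightarrow> complex ^ 'n \<Rightarrow> 'f::{chilbert_space, second_countable_topology}"
    and \<Theta> :: "complex ^ 'n \<Rightarrow> 'e \<Rightarrow>\<^sub>L 'f"
  assumes "drury_arveson ev"
    and "function_tensor (ball 0 1) ev evE"
    and "function_tensor (ball 0 1) ev evF"
    and "multiplier evE evF \<Theta>"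
  shows "has_regular_inverse evE evF \<Theta> \<longleftrightarrow>
    (\<exists>S. submodule evF S \<and> algebraic_direct_sum (range (mult_op evE evF \<Theta>)) S)"
proof -
  obtain \<kappa>E \<kappa>F where "vector_drury_arveson evE \<kappa>E" "vector_drury_arveson evF \<kappa>F"
    using vector_drury_arveson_exists[OF assms(1,2)] vector_drury_arveson_exists[OF assms(1,3)] by blast
  then show ?thesis
    using assms(4) regular_inverse_imp_complemented complemented_imp_regular_inverse by blast
qed

end
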